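(* Let $R\ge 1$ and $0\le m<2^R$, and put $n=2^R+m$. Then \[ a_2(n)=\begin{cases}2^R\,a_2(m)+\binom{2^{R-1}}{2}\,a(m),& m<2^{R-1},\\[4pt] 2^R\,a_2(m)+\left(\binom{2^{R-1}}{3}+2^{R-1}\right)\dfrac{a(m)}{2^{R-1}},& 2^{R-1}\le m<2^R.\end{cases} \]
   Context: For a partition $\lambda$, $f^\lambda$ denotes the number of standard Young tableaux of shape $\lambda$. For $n\ge 0$, $a_i(n)$ is the number of partitions $\lambda$ of $n$ with $f^\lambda\equiv i\pmod 4$, and $a(n):=a_1(n)+a_3(n)$ is the number of partitions of $n$ with odd $f^\lambda$. Conventions for $n=0$: the only partition of $0$ is the empty partition with $f^\varnothing=1$, so $a(0)=1$ and $a_2(0)=0$. *)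

theory Defs
  imports Complex_Main
begin

definition partitions :: "nat \<Rightarrow> nat list set" where
  "partitions n = {lam. sorted (rev lam) \<and> 0 \<notin> set lam \<and> sum_list lam = n}"

definition cells :: "nat list \<Rightarrow> (nat \<times> nat) set" where
  "cells lam = {(i, j). i < length lam \<and> j < lam ! i}"

definition SYT :: "nat list \<Rightarrow> (nat \<times> nat \<Rightarrow> nat) set" where
  "SYT lam = {T. (\<forall>c. c \<notin> cells lam \<longrightarrow> T c = 0)
      \<and> bij_betw T (cells lam) {1..sum_list lam}
      \<and> (\<forall>i j. (i, Suc j) \<in> cells lam \<longrightarrow> T (i, j) < T (i, Suc j))
      \<and> (\<forall>i j. (Suc i, j) \<in> cells lam \<longrightarrow> T (i, j) < T (Suc i, j))}"

definition f_syt :: "nat list \<Rightarrow> nat" where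
  "f_syt lam = card (SYT lam)"

definition a_mod4 :: "nat \<Rightarrow> nat \<Rightarrow> nat" where
  "a_mod4 i n = card {lam \<in> partitions n. f_syt lam mod 4 = i}"

definition a_odd :: "nat \<Rightarrow> nat" where
  "a_odd n = a_mod4 1 n + a_mod4 3 n"

end

theory Submission
  imports Defs "HOL-Computational_Algebra.Primes"
begin

text \<open>
  By the branching rule, the number \<open>f\<close> of standard tableaux of a partition of \<open>n\<close> with beta set
  \<open>B\<close> satisfies Frobenius' formula \<open>f * (\<Prod>b\<in>B. b!) = n! * (\<Prod>x < y in B. y - x)\<close>. Writing \<open>B\<close> as
  the union of \<open>2 X\<close> and \<open>2 Y + 1\<close> (Macdonald's 2-quotient) the 2-adic valuation of \<open>f\<close> becomes a sum
  of the valuations attached to \<open>X\<close> and \<open>Y\<close>, of the valuation of a binomial coefficient, and of a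
  contribution of the 2-core, which exceeds 1 unless the core has size 0, 1 or 3. Hence the numbers
  of partitions of \<open>n\<close> with valuation 0 and 1 are convolutions of the same numbers over pairs
  \<open>u + w = n div 2\<close> whose binary addition has no carry or exactly one, and the theorem follows by
  induction on the top bit of \<open>n\<close>.
\<close>

subsection \<open>Branching rule for standard Young tableaux\<close>

text \<open>Only the valuations 0 and 1 are tracked: \<open>f\<close> is odd or congruent to 2 mod 4
  exactly in these cases, so the residues 1 and 3 never have to be separated. The number
  \<open>k\<close> of beta numbers is a free parameter. Taking \<open>k \<ge> n\<close> leaves room
  for every partition of \<open>n\<close>, and taking \<open>k = 2 * c\<close> makes the 2-core
  depend only on the imbalance \<open>e\<close> between X and Y. The constants come from recurrences
  in \<open>H = 2 ^ (R - 1)\<close>. Halving \<open>n\<close> halves \<open>H\<close>. The top bit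
  of \<open>n div 2\<close> goes to one of the two summands, or it arises from a single carry
  between two equal bits. This gives \<open>L(2 H) = 2 L(H) + H^2\<close> for \<open>m\<close> below
  the half and \<open>U(2 H) = L(H) + U(H)\<close> above it. The start is \<open>L(1) = 0\<close>
  and \<open>U(1) = 1\<close>, where the 1 is the core of size 3 at \<open>n = 3\<close>. The
  binomial expressions of the theorem solve these recurrences.\<close>

definition decr :: "nat list \<Rightarrow> nat \<Rightarrow> nat list" where
  "decr lam i = lam[i := lam ! i - 1]"

text \<open>Zero rows are permitted and \<open>decr\<close> never shortens the list, so the number
  of beta numbers stays fixed while cells are removed; hence the test
  \<open>0 < lam ! i\<close>.\<close>

definition corner_rows :: "nat list \<Rightarrow> nat set" where
  "corner_rows lam = {i. i < length lam \<and> 0 < lam ! i \<and>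
     (Suc i < length lam \<longrightarrow> lam ! Suc i < lam ! i)}"

lemma finite_corner_rows [simp]: "finite (corner_rows lam)"
  by (rule finite_subset[of _ "{..<length lam}"]) (auto simp: corner_rows_def)

lemma cells_decr:
  assumes "i \<in> corner_rows lam"
  shows "cells (decr lam i) = cells lam - {(i, lam ! i - 1)}"
  using assms by (auto simp: cells_def decr_def corner_rows_def nth_list_update split: if_splits)

lemma corner_cell_in:
  assumes "i \<in> corner_rows lam"
  shows "(i, lam ! i - 1) \<in> cells lam"
  using assms by (auto simp: cells_def corner_rows_def)

lemma sum_list_decr:
  assumes "i \<in> corner_rows lam"
  shows "Suc (sum_list (decr lam i)) = sum_list lam"
proof -
  have "lam ! i \<le> sum_list lam"
    using assms by (intro member_le_sum_list) (auto simp: corner_rows_def)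
  thus ?thesis
    using assms by (auto simp: decr_def corner_rows_def sum_list_update)
qed

lemma sorted_rev_decr:
  assumes "i \<in> corner_rows lam" "sorted (rev lam)"
  shows "sorted (rev (decr lam i))"
proof -
  have mono: "lam ! b \<le> lam ! a" if "a \<le> b" "b < length lam" for a b
    using assms(2) that by (simp add: sorted_rev_nth_mono)
  have "decr lam i ! b \<le> decr lam i ! a" if ab: "a \<le> b" "b < length lam" for a b
  proof (cases "a = i \<and> b > i")
    case True
    hence "lam ! b \<le> lam ! Suc i" using ab mono[of "Suc i" b] by simp
    moreover have "lam ! Suc i < lam ! i"
      using assms(1) True ab by (auto simp: corner_rows_def)
    ultimately show ?thesis using True ab by (auto simp: decr_def)
  next
    case False
    thus ?thesis using mono[OF ab] ab
      by (cases "a = i"; cases "b = i") (auto simp: decr_def nth_list_update intro: diff_le_mono le_trans[OF diff_le_self])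
  qed
  thus ?thesis
    by (simp add: sorted_rev_iff_nth_mono decr_def)
qed

lemma finite_cells [simp]: "finite (cells lam)"
proof -
  have "cells lam = (SIGMA i:{..<length lam}. {..<lam ! i})"
    by (auto simp: cells_def)
  thus ?thesis by simp
qed

lemma finite_SYT [simp]: "finite (SYT lam)"
proof (rule finite_subset)
  show "SYT lam \<subseteq> {T. (\<forall>c. (c \<in> cells lam \<longrightarrow> T c \<in> {1..sum_list lam}) \<and> (c \<notin> cells lam \<longrightarrow> T c = 0))}"
    unfolding SYT_def bij_betw_def by blast
  show "finite \<dots>"
    by (rule finite_set_of_finite_funs) auto
qed

lemma SYT_outside: "T \<in> SYT lam \<Longrightarrow> c \<notin> cells lam \<Longrightarrow> T c = 0"
  by (cases c) (simp add: SYT_def)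

lemma SYT_bij: "T \<in> SYT lam \<Longrightarrow> bij_betw T (cells lam) {1..sum_list lam}"
  by (simp add: SYT_def)

lemma SYT_row: "T \<in> SYT lam \<Longrightarrow> (i, Suc j) \<in> cells lam \<Longrightarrow> T (i, j) < T (i, Suc j)"
  by (simp add: SYT_def)

lemma SYT_col: "T \<in> SYT lam \<Longrightarrow> (Suc i, j) \<in> cells lam \<Longrightarrow> T (i, j) < T (Suc i, j)"
  by (simp add: SYT_def)

lemma SYT_I:
  assumes "\<And>c. c \<notin> cells lam \<Longrightarrow> T c = 0"
    and "bij_betw T (cells lam) {1..sum_list lam}"
    and "\<And>i j. (i, Suc j) \<in> cells lam \<Longrightarrow> T (i, j) < T (i, Suc j)"
    and "\<And>i j. (Suc i, j) \<in> cells lam \<Longrightarrow> T (i, j) < T (Suc i, j)"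
  shows "T \<in> SYT lam"
  using assms by (simp add: SYT_def)

lemma SYT_extend:
  assumes i: "i \<in> corner_rows lam" and T: "T \<in> SYT (decr lam i)"
  shows "T((i, lam ! i - 1) := sum_list lam) \<in> SYT lam"
proof -
  let ?c = "(i, lam ! i - 1)" and ?n = "sum_list lam"
  let ?T = "T(?c := ?n)"
  have n: "?n = Suc (sum_list (decr lam i))" using sum_list_decr[OF i] by simp
  have cells: "cells lam = insert ?c (cells (decr lam i))" "?c \<notin> cells (decr lam i)"
    using cells_decr[OF i] corner_cell_in[OF i] by auto
  have bij: "bij_betw T (cells (decr lam i)) {1..sum_list (decr lam i)}"
    using T by (simp add: SYT_def)
  have small: "T c < ?n" for c
  proof (cases "c \<in> cells (decr lam i)")
    case True
    hence "T c \<in> {1..sum_list (decr lam i)}" using bij by (auto simp: bij_betw_def)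
    thus ?thesis using n by auto
  next
    case False
    thus ?thesis using SYT_outside[OF T] n by simp
  qed
  have "bij_betw ?T (cells lam) {1..?n}"
  proof -
    have "bij_betw ?T (cells (decr lam i) \<union> {?c}) ({1..sum_list (decr lam i)} \<union> {?n})"
    proof (rule bij_betw_combine)
      show "bij_betw ?T (cells (decr lam i)) {1..sum_list (decr lam i)}"
        using bij cells(2) by (subst bij_betw_cong[where g = T]) auto
      show "bij_betw ?T {?c} {?n}" by (simp add: bij_betw_def)
      show "{1..sum_list (decr lam i)} \<inter> {?n} = {}" using n by auto
    qed
    moreover have "{1..sum_list (decr lam i)} \<union> {?n} = {1..?n}" using n by auto
    ultimately show ?thesis using cells(1) by simp
  qed
  moreover have "?T c = 0" if "c \<notin> cells lam" for c
    using that SYT_outside[OF T, of c] cells by auto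
  moreover have "?T (a, b) < ?T (a, Suc b)" if "(a, Suc b) \<in> cells lam" for a b
  proof -
    have "(a, b) \<noteq> ?c" using that by (auto simp: cells_def)
    moreover have "T (a, b) < T (a, Suc b)" if "(a, Suc b) \<noteq> ?c"
      using that SYT_row[OF T] \<open>(a, Suc b) \<in> cells lam\<close> cells(1) by auto
    ultimately show ?thesis using small by auto
  qed
  moreover have "?T (a, b) < ?T (Suc a, b)" if "(Suc a, b) \<in> cells lam" for a b
  proof -
    have "(a, b) \<noteq> ?c" using that i by (auto simp: cells_def corner_rows_def)
    moreover have "T (a, b) < T (Suc a, b)" if "(Suc a, b) \<noteq> ?c"
      using that SYT_col[OF T] \<open>(Suc a, b) \<in> cells lam\<close> cells(1) by auto
    ultimately show ?thesis using small by auto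
  qed
  ultimately show ?thesis by (intro SYT_I)
qed

text \<open>The largest entry must end both its row and its column, so its cell is a corner and can
  be deleted.\<close>

lemma SYT_restrict:
  assumes T: "T \<in> SYT lam" and s: "sorted (rev lam)" and pos: "0 < sum_list lam"
  obtains i T' where "i \<in> corner_rows lam" "T' \<in> SYT (decr lam i)"
    "T = T'((i, lam ! i - 1) := sum_list lam)"
proof -
  let ?n = "sum_list lam"
  have bij: "bij_betw T (cells lam) {1..?n}" using T by (simp add: SYT_def)
  have le: "T c \<le> ?n" for c
  proof (cases "c \<in> cells lam")
    case True
    hence "T c \<in> {1..?n}" using bij by (auto simp: bij_betw_def)
    thus ?thesis by simp
  next
    case False
    thus ?thesis using SYT_outside[OF T] by simp
  qed
  have "?n \<in> T ` cells lam" using bij pos by (auto simp: bij_betw_def)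
  then obtain i j where ij: "(i, j) \<in> cells lam" "T (i, j) = ?n" by auto
  have "\<not> Suc j < lam ! i"
  proof
    assume "Suc j < lam ! i"
    hence "(i, Suc j) \<in> cells lam" using ij by (auto simp: cells_def)
    hence "T (i, j) < T (i, Suc j)" by (rule SYT_row[OF T])
    thus False using ij le[of "(i, Suc j)"] by simp
  qed
  hence j: "j = lam ! i - 1" and j': "j < lam ! i" "i < length lam" using ij by (auto simp: cells_def)
  have "lam ! Suc i < lam ! i" if "Suc i < length lam"
  proof (rule ccontr)
    assume "\<not> ?thesis"
    hence "(Suc i, j) \<in> cells lam" using j' that by (auto simp: cells_def)
    hence "T (i, j) < T (Suc i, j)" by (rule SYT_col[OF T])
    thus False using ij le[of "(Suc i, j)"] by simp
  qed
  hence i: "i \<in> corner_rows lam" using j' by (auto simp: corner_rows_def)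
  \<comment> \<open>Tableaux are 0 off their diagram, so the vacated cell has to be reset to
    0.\<close>
  define T' where "T' = T((i, j) := 0)"
  have n: "?n = Suc (sum_list (decr lam i))" using sum_list_decr[OF i] by simp
  have cells: "cells (decr lam i) = cells lam - {(i, j)}" using cells_decr[OF i] j by simp
  have "bij_betw T' (cells (decr lam i)) {1..sum_list (decr lam i)}"
  proof -
    have "bij_betw T (cells lam - {(i, j)}) ({1..?n} - {?n})"
      using bij_betw_DiffI[OF bij, of "{(i, j)}" "{?n}"] ij pos by (auto simp: bij_betw_def)
    moreover have "{1..?n} - {?n} = {1..sum_list (decr lam i)}" using n by auto
    ultimately show ?thesis
      unfolding cells T'_def by (subst bij_betw_cong[where g = T]) auto
  qed
  moreover have "T' c = 0" if "c \<notin> cells (decr lam i)" for c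
  proof -
    have "c \<in> cells lam \<or> T c = 0" using SYT_outside[OF T, of c] by (cases "c \<in> cells lam") auto
    thus ?thesis using that cells by (auto simp: T'_def)
  qed
  moreover have "T' (a, b) < T' (a, Suc b)" if ab: "(a, Suc b) \<in> cells (decr lam i)" for a b
  proof -
    have "T (a, b) < T (a, Suc b)" using ab SYT_row[OF T] cells by simp
    moreover have "(a, Suc b) \<noteq> (i, j)" using ab unfolding cells by blast
    ultimately show ?thesis by (cases "(a, b) = (i, j)") (auto simp: T'_def)
  qed
  moreover have "T' (a, b) < T' (Suc a, b)" if ab: "(Suc a, b) \<in> cells (decr lam i)" for a b
  proof -
    have "T (a, b) < T (Suc a, b)" using ab SYT_col[OF T] cells by simp
    moreover have "(Suc a, b) \<noteq> (i, j)" using ab unfolding cells by blast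
    ultimately show ?thesis by (cases "(a, b) = (i, j)") (auto simp: T'_def)
  qed
  ultimately have "T' \<in> SYT (decr lam i)" by (intro SYT_I)
  moreover have "T = T'((i, lam ! i - 1) := ?n)" using ij j by (auto simp: T'_def)
  ultimately show thesis using that i by blast
qed

text \<open>Tableaux are classified by the corner that holds the largest entry.\<close>

lemma f_syt_branching:
  assumes s: "sorted (rev lam)" and pos: "0 < sum_list lam"
  shows "f_syt lam = (\<Sum>i\<in>corner_rows lam. f_syt (decr lam i))"
proof -
  define ext where "ext = (\<lambda>i (T :: nat \<times> nat \<Rightarrow> nat). T((i, lam ! i - 1) := sum_list lam))"
  \<comment> \<open>The value overwritten by \<open>ext i\<close> is always 0, which makes
    \<open>ext i\<close> injective.\<close>
  have vanish: "T (i, lam ! i - 1) = 0" if "i \<in> corner_rows lam" "T \<in> SYT (decr lam i)" for i T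
    using that cells_decr[OF that(1)] by (intro SYT_outside[OF that(2)]) auto
  have small: "T c < sum_list lam" if "i \<in> corner_rows lam" "T \<in> SYT (decr lam i)" for i T c
  proof (cases "c \<in> cells (decr lam i)")
    case True
    hence "T c \<in> {1..sum_list (decr lam i)}" using SYT_bij[OF that(2)] by (auto simp: bij_betw_def)
    thus ?thesis using sum_list_decr[OF that(1)] by auto
  next
    case False
    thus ?thesis using SYT_outside[OF that(2)] pos by simp
  qed
  have "SYT lam = (\<Union>i\<in>corner_rows lam. ext i ` SYT (decr lam i))"
  proof (intro equalityI subsetI)
    fix T assume "T \<in> SYT lam"
    then obtain i T' where "i \<in> corner_rows lam" "T' \<in> SYT (decr lam i)" "T = ext i T'"
      using SYT_restrict[OF _ s pos] unfolding ext_def by metis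
    thus "T \<in> (\<Union>i\<in>corner_rows lam. ext i ` SYT (decr lam i))" by blast
  next
    fix T assume "T \<in> (\<Union>i\<in>corner_rows lam. ext i ` SYT (decr lam i))"
    then obtain i T' where "i \<in> corner_rows lam" "T' \<in> SYT (decr lam i)" "T = ext i T'"
      by blast
    thus "T \<in> SYT lam" using SYT_extend by (simp add: ext_def)
  qed
  hence "f_syt lam = card (\<Union>i\<in>corner_rows lam. ext i ` SYT (decr lam i))"
    by (simp add: f_syt_def)
  also have "\<dots> = (\<Sum>i\<in>corner_rows lam. card (ext i ` SYT (decr lam i)))"
  proof (rule card_UN_disjoint)
    show "\<forall>i\<in>corner_rows lam. \<forall>j\<in>corner_rows lam. i \<noteq> j \<longrightarrow>
        ext i ` SYT (decr lam i) \<inter> ext j ` SYT (decr lam j) = {}"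
    proof (intro ballI impI)
      fix i j assume ij: "i \<in> corner_rows lam" "j \<in> corner_rows lam" "i \<noteq> j"
      \<comment> \<open>The largest entry of \<open>ext i T\<close> sits in corner \<open>i\<close>,
        where \<open>ext j U\<close> still has a smaller entry of \<open>U\<close>.\<close>
      have False if "T \<in> SYT (decr lam i)" "U \<in> SYT (decr lam j)" "ext i T = ext j U" for T U
      proof -
        have "ext j U (i, lam ! i - 1) = sum_list lam"
          unfolding that(3)[symmetric] by (simp add: ext_def)
        thus False using small[OF ij(2) that(2), of "(i, lam ! i - 1)"] ij(3)
          by (auto simp: ext_def)
      qed
      thus "ext i ` SYT (decr lam i) \<inter> ext j ` SYT (decr lam j) = {}" by blast
    qed
  qed auto
  also have "\<dots> = (\<Sum>i\<in>corner_rows lam. f_syt (decr lam i))"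
  proof (rule sum.cong)
    fix i assume i: "i \<in> corner_rows lam"
    have "inj_on (ext i) (SYT (decr lam i))"
    proof (rule inj_onI)
      fix T U assume TU: "T \<in> SYT (decr lam i)" "U \<in> SYT (decr lam i)" "ext i T = ext i U"
      show "T = U"
      proof
        fix c
        have "ext i T c = ext i U c" using TU by simp
        thus "T c = U c" using vanish[OF i TU(1)] vanish[OF i TU(2)]
          by (auto simp: ext_def split: if_splits)
      qed
    qed
    thus "card (ext i ` SYT (decr lam i)) = f_syt (decr lam i)"
      by (simp add: card_image f_syt_def)
  qed auto
  finally show ?thesis .
qed

lemma f_syt_empty:
  assumes "sum_list lam = 0"
  shows "f_syt lam = 1"
proof -
  have cells: "cells lam = {}" using assms nth_mem by (fastforce simp: cells_def)
  have "SYT lam = {\<lambda>_. 0}"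
  proof (intro equalityI subsetI)
    fix T assume "T \<in> SYT lam"
    thus "T \<in> {\<lambda>_. 0}" using SYT_outside cells by (auto simp: fun_eq_iff)
  next
    fix T :: "nat \<times> nat \<Rightarrow> nat" assume "T \<in> {\<lambda>_. 0}"
    thus "T \<in> SYT lam" using cells assms by (intro SYT_I) (auto simp: bij_betw_def)
  qed
  thus ?thesis by (simp add: f_syt_def)
qed

subsection \<open>Frobenius degree formula\<close>

definition shift_coeff :: "nat set \<Rightarrow> nat \<Rightarrow> real" where
  "shift_coeff S x = (\<Prod>y\<in>S - {x}. 1 - 1 / (real x - real y))"

text \<open>With \<open>u = z - x\<close> and \<open>v = z - w\<close> the difference
  \<open>v - u = x - w\<close> is free of \<open>z\<close>, so a product of two simple poles splits
  into separate poles with constant coefficients.\<close>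

lemma partial_fractions_pole_exchange:
  fixes c u v :: real
  assumes "u \<noteq> 0" "v \<noteq> 0" "u \<noteq> v"
  shows "c / u * (1 - 1 / v) = (1 - 1 / (v - u)) * c / u - c / (u - v) / v"
proof -
  have "1 / (v - u) * c / u - c / (v - u) / v = c * (v - u) / ((v - u) * u * v)"
    using assms by (simp add: divide_simps) (simp add: algebra_simps)
  also have "\<dots> = c / u / v" using assms by simp
  finally have "c / u / v = 1 / (v - u) * c / u - c / (v - u) / v" by simp
  moreover have "c / (u - v) / v = - (c / (v - u) / v)"
    by (metis minus_diff_eq minus_divide_left minus_divide_right)
  ultimately show ?thesis by (simp add: algebra_simps diff_divide_distrib)
qed

lemma shift_coeff_insert:
  assumes "finite S" "w \<notin> S" "x \<in> S"
  shows "shift_coeff (insert w S) x = (1 - 1 / (real x - real w)) * shift_coeff S x"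
proof -
  have "insert w S - {x} = insert w (S - {x})" using assms by auto
  thus ?thesis using assms by (simp add: shift_coeff_def)
qed

lemma shift_coeff_insert_same:
  assumes "w \<notin> S"
  shows "shift_coeff (insert w S) w = (\<Prod>y\<in>S. 1 - 1 / (real w - real y))"
  using assms by (simp add: shift_coeff_def)

text \<open>As a function of \<open>z\<close> the product tends to 1 at infinity and has a simple
  pole at each \<open>x\<close> in \<open>S\<close>, with residue
  \<open>- shift_coeff S x\<close>.\<close>

lemma shift_partial_fractions:
  assumes "finite S" "z \<notin> S"
  shows "(\<Prod>y\<in>S. 1 - 1 / (real z - real y)) = 1 - (\<Sum>x\<in>S. shift_coeff S x / (real z - real x))"
  using assms
proof (induction S arbitrary: z rule: finite_induct)
  case empty
  thus ?case by simp
next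
  case (insert w S)
  let ?c = "shift_coeff S"
  have z: "z \<noteq> w" "z \<notin> S" using insert.prems by auto
  have pf: "?c x / (real z - real x) * (1 - 1 / (real z - real w)) =
      (1 - 1 / (real x - real w)) * ?c x / (real z - real x)
        - ?c x / (real w - real x) / (real z - real w)" if "x \<in> S" for x
  proof -
    have "x \<noteq> w" "z \<noteq> x" using that insert.hyps z by auto
    thus ?thesis
      using z partial_fractions_pole_exchange[of "real z - real x" "real z - real w" "?c x"] by simp
  qed
  have "(\<Prod>y\<in>insert w S. 1 - 1 / (real z - real y)) =
      (1 - (\<Sum>x\<in>S. ?c x / (real z - real x))) * (1 - 1 / (real z - real w))"
    using insert.hyps insert.IH[OF z(2)] by simp
  also have "\<dots> = 1 - 1 / (real z - real w)
      - (\<Sum>x\<in>S. ?c x / (real z - real x) * (1 - 1 / (real z - real w)))"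
    by (simp add: left_diff_distrib sum_distrib_right)
  \<comment> \<open>The coefficient collected at the new pole is the product over \<open>S\<close>
    evaluated at \<open>w\<close>; this is why the induction hypothesis is used at \<open>w\<close>
    as well as at \<open>z\<close>.\<close>
  also have "\<dots> = 1 - (1 - (\<Sum>x\<in>S. ?c x / (real w - real x))) / (real z - real w)
      - (\<Sum>x\<in>S. (1 - 1 / (real x - real w)) * ?c x / (real z - real x))"
  proof -
    have "(\<Sum>x\<in>S. ?c x / (real z - real x) * (1 - 1 / (real z - real w))) =
        (\<Sum>x\<in>S. (1 - 1 / (real x - real w)) * ?c x / (real z - real x)
          - ?c x / (real w - real x) / (real z - real w))"
      by (intro sum.cong refl pf)
    thus ?thesis by (simp add: sum_subtractf sum_divide_distrib diff_divide_distrib)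
  qed
  also have "\<dots> = 1 - (\<Sum>x\<in>insert w S. shift_coeff (insert w S) x / (real z - real x))"
    using insert.hyps insert.IH[OF insert.hyps(2)]
    by (simp add: shift_coeff_insert shift_coeff_insert_same)
  finally show ?case .
qed

text \<open>This is the coefficient of \<open>1 / z\<close> at infinity in the partial fraction
  expansion; an induction replaces the limit.\<close>

lemma sum_shift_coeff:
  assumes "finite S"
  shows "(\<Sum>x\<in>S. shift_coeff S x) = real (card S)"
  using assms
proof (induction S rule: finite_induct)
  case empty
  thus ?case by simp
next
  case (insert w S)
  let ?c = "shift_coeff S"
  have pf: "(1 - 1 / (real x - real w)) * ?c x = ?c x + ?c x / (real w - real x)"
    if "x \<in> S" for x
  proof -
    have "x \<noteq> w" using that insert.hyps by auto
    thus ?thesis by (simp add: field_simps)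
  qed
  have "(\<Sum>x\<in>insert w S. shift_coeff (insert w S) x) =
      1 - (\<Sum>x\<in>S. ?c x / (real w - real x)) + (\<Sum>x\<in>S. (1 - 1 / (real x - real w)) * ?c x)"
    using insert.hyps
    by (simp add: shift_coeff_insert shift_coeff_insert_same shift_partial_fractions)
  also have "\<dots> = 1 + real (card S)"
    using insert.IH by (simp add: pf sum.distrib)
  finally show ?case using insert.hyps by simp
qed

text \<open>This is the coefficient of \<open>1 / z^2\<close> at infinity. For a beta set the
  right-hand side is the size \<open>n\<close> of the partition, the factor that turns
  \<open>(n - 1)!\<close> into \<open>n!\<close> in the degree formula.\<close>

lemma sum_mult_shift_coeff:
  assumes "finite S"
  shows "(\<Sum>x\<in>S. real x * shift_coeff S x) = real (\<Sum>S) - real (card S choose 2)"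
  using assms
proof (induction S rule: finite_induct)
  case empty
  thus ?case by simp
next
  case (insert w S)
  let ?c = "shift_coeff S"
  have pf: "real x * ((1 - 1 / (real x - real w)) * ?c x) =
      real x * ?c x + real w * (?c x / (real w - real x)) - ?c x" if "x \<in> S" for x
  proof -
    have "x \<noteq> w" using that insert.hyps by auto
    thus ?thesis by (simp add: field_simps)
  qed
  have "(\<Sum>x\<in>insert w S. real x * shift_coeff (insert w S) x) =
      real w * (1 - (\<Sum>x\<in>S. ?c x / (real w - real x)))
        + (\<Sum>x\<in>S. real x * ((1 - 1 / (real x - real w)) * ?c x))"
    using insert.hyps
    by (simp add: shift_coeff_insert shift_coeff_insert_same shift_partial_fractions)
  also have "\<dots> = real w + (\<Sum>x\<in>S. real x * ?c x) - (\<Sum>x\<in>S. ?c x)"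
    by (simp add: pf sum.distrib sum_subtractf sum_distrib_left right_diff_distrib)
  also have "\<dots> = real w + real (\<Sum>S) - real (card S choose 2) - real (card S)"
    using insert.IH insert.hyps by (simp add: sum_shift_coeff)
  finally show ?case using insert.hyps by (simp add: choose_reduce_nat[of "Suc _" 2] numeral_2_eq_2)
qed

section \<open>Products of differences\<close>

definition gap_pairs :: "nat set \<Rightarrow> (nat \<times> nat) set" where
  "gap_pairs S = {(x, y). x \<in> S \<and> y \<in> S \<and> x < y}"

definition gap_prod :: "nat set \<Rightarrow> nat" where
  "gap_prod S = (\<Prod>(x, y)\<in>gap_pairs S. y - x)"

lemma finite_gap_pairs [simp]: "finite S \<Longrightarrow> finite (gap_pairs S)"
  by (rule finite_subset[of _ "S \<times> S"]) (auto simp: gap_pairs_def)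

lemma gap_pairs_insert:
  assumes "z \<notin> S"
  shows "gap_pairs (insert z S) = gap_pairs S \<union> (\<lambda>x. (min x z, max x z)) ` S"
    and "gap_pairs S \<inter> (\<lambda>x. (min x z, max x z)) ` S = {}"
    and "inj_on (\<lambda>x. (min x z, max x z)) S"
proof -
  show "gap_pairs (insert z S) = gap_pairs S \<union> (\<lambda>x. (min x z, max x z)) ` S"
  proof (intro equalityI subsetI)
    fix p assume p: "p \<in> gap_pairs (insert z S)"
    then obtain x y where xy: "p = (x, y)" "x < y" "x \<in> insert z S" "y \<in> insert z S"
      by (auto simp: gap_pairs_def)
    show "p \<in> gap_pairs S \<union> (\<lambda>x. (min x z, max x z)) ` S"
    proof (cases "x = z \<or> y = z")
      case True
      hence "p = (\<lambda>x. (min x z, max x z)) (if x = z then y else x)" "(if x = z then y else x) \<in> S"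
        using xy by auto
      thus ?thesis by blast
    next
      case False
      thus ?thesis using xy by (auto simp: gap_pairs_def)
    qed
  next
    fix p assume "p \<in> gap_pairs S \<union> (\<lambda>x. (min x z, max x z)) ` S"
    thus "p \<in> gap_pairs (insert z S)"
    proof
      assume "p \<in> (\<lambda>x. (min x z, max x z)) ` S"
      then obtain x where "x \<in> S" "p = (min x z, max x z)" by blast
      moreover have "x \<noteq> z" using assms \<open>x \<in> S\<close> by auto
      ultimately show ?thesis by (auto simp: gap_pairs_def min_def max_def)
    qed (auto simp: gap_pairs_def)
  qed
  show "gap_pairs S \<inter> (\<lambda>x. (min x z, max x z)) ` S = {}"
    using assms by (auto simp: gap_pairs_def min_def max_def split: if_splits)
  show "inj_on (\<lambda>x. (min x z, max x z)) S"
    using assms by (auto simp: inj_on_def min_def max_def split: if_splits)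
qed

lemma card_gap_pairs: "finite S \<Longrightarrow> card (gap_pairs S) = card S choose 2"
proof (induction S rule: finite_induct)
  case empty
  thus ?case by (simp add: gap_pairs_def)
next
  case (insert z S)
  have "card (gap_pairs (insert z S)) = card (gap_pairs S) + card S"
    using insert.hyps gap_pairs_insert[OF insert.hyps(2)]
    by (simp add: card_Un_disjoint card_image)
  thus ?case using insert by (simp add: choose_reduce_nat[of "Suc _" 2] numeral_2_eq_2)
qed

lemma gap_prod_pos: "finite S \<Longrightarrow> 0 < gap_prod S"
  unfolding gap_prod_def by (rule prod_pos) (auto simp: gap_pairs_def)

lemma gap_prod_insert:
  assumes "finite S" "z \<notin> S"
  shows "real (gap_prod (insert z S)) = real (gap_prod S) * (\<Prod>x\<in>S. \<bar>real z - real x\<bar>)"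
proof -
  let ?g = "\<lambda>x. (min x z, max x z)"
  have "gap_prod (insert z S) = gap_prod S * (\<Prod>(x, y)\<in>?g ` S. y - x)"
    unfolding gap_prod_def gap_pairs_insert(1)[OF assms(2)]
    by (rule prod.union_disjoint) (use assms gap_pairs_insert(2)[OF assms(2)] in auto)
  also have "(\<Prod>(x, y)\<in>?g ` S. y - x) = (\<Prod>x\<in>S. max x z - min x z)"
    by (subst prod.reindex[OF gap_pairs_insert(3)[OF assms(2)]]) simp
  also have "real (gap_prod S * \<dots>) = real (gap_prod S) * (\<Prod>x\<in>S. \<bar>real z - real x\<bar>)"
    by (simp add: of_nat_prod) (intro disjI2 prod.cong, auto simp: max_def min_def)
  finally show ?thesis .
qed

text \<open>As \<open>b - 1\<close> is free, every other element lies below \<open>b - 1\<close> or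
  above \<open>b\<close>. No difference changes sign, and each is multiplied by one factor of
  \<open>shift_coeff S b\<close>.\<close>

lemma gap_prod_lower:
  assumes "finite S" "b \<in> S" "0 < b" "b - 1 \<notin> S"
  shows "real (gap_prod (insert (b - 1) (S - {b}))) = real (gap_prod S) * shift_coeff S b"
proof -
  have "\<bar>real (b - 1) - real x\<bar> = \<bar>real b - real x\<bar> * (1 - 1 / (real b - real x))"
    if x: "x \<in> S - {b}" for x
  proof -
    have "x \<noteq> b - 1" "x \<noteq> b" using x assms by auto
    hence "x < b - 1 \<or> b < x" using assms by linarith
    thus ?thesis using assms by (auto simp: field_simps abs_if of_nat_diff)
  qed
  hence "(\<Prod>x\<in>S - {b}. \<bar>real (b - 1) - real x\<bar>) =
      (\<Prod>x\<in>S - {b}. \<bar>real b - real x\<bar>) * shift_coeff S b"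
    by (simp add: shift_coeff_def prod.distrib)
  moreover have "real (gap_prod (insert (b - 1) (S - {b}))) =
      real (gap_prod (S - {b})) * (\<Prod>x\<in>S - {b}. \<bar>real (b - 1) - real x\<bar>)"
    using assms by (intro gap_prod_insert) auto
  moreover have "real (gap_prod (insert b (S - {b}))) =
      real (gap_prod (S - {b})) * (\<Prod>x\<in>S - {b}. \<bar>real b - real x\<bar>)"
    using assms by (intro gap_prod_insert) auto
  moreover have "insert b (S - {b}) = S" using assms by auto
  ultimately show ?thesis by simp
qed

text \<open>Base case of the degree formula: \<open>k\<close> zero rows have beta set
  \<open>{..<k}\<close>, and the gaps cancel the factorials.\<close>

lemma gap_prod_lessThan: "gap_prod {..<k} = (\<Prod>b<k. fact b)"
proof (induction k)
  case 0
  show ?case by (simp add: gap_prod_def gap_pairs_def)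
next
  case (Suc k)
  have "(\<Prod>x<k. \<bar>real k - real x\<bar>) = (\<Prod>x<k. real (k - x))"
    by (rule prod.cong) auto
  also have "\<dots> = real (\<Prod>x<k. k - x)" by simp
  also have "(\<Prod>x<k. k - x) = fact k"
    using fact_prod_rev[of k, where 'a = nat] by (simp add: lessThan_atLeast0)
  finally have "real (gap_prod {..<Suc k}) = real (gap_prod {..<k} * fact k)"
    using gap_prod_insert[of "{..<k}" k] by (simp add: lessThan_Suc)
  hence "gap_prod {..<Suc k} = gap_prod {..<k} * fact k" using of_nat_eq_iff by blast
  thus ?case using Suc by simp
qed

section \<open>Beta numbers and the degree formula\<close>

definition beta_num :: "nat list \<Rightarrow> nat \<Rightarrow> nat" where
  "beta_num lam i = lam ! i + (length lam - Suc i)"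

text \<open>These are the first-column hook lengths when no row is zero; trailing zero rows
  contribute an initial segment 0, 1, and so on.\<close>

definition beta_set :: "nat list \<Rightarrow> nat set" where
  "beta_set lam = beta_num lam ` {..<length lam}"

lemma finite_beta_set [simp]: "finite (beta_set lam)"
  by (simp add: beta_set_def)

lemma beta_num_less:
  assumes "sorted (rev lam)" "i < j" "j < length lam"
  shows "beta_num lam j < beta_num lam i"
  using sorted_rev_nth_mono[OF assms(1), of i j] assms(2,3) by (simp add: beta_num_def)

lemma inj_on_beta_num: 
  assumes "sorted (rev lam)"
  shows "inj_on (beta_num lam) {..<length lam}"
proof (rule inj_onI)
  fix i j assume "i \<in> {..<length lam}" "j \<in> {..<length lam}" "beta_num lam i = beta_num lam j"
  thus "i = j" using beta_num_less[OF assms, of i j] beta_num_less[OF assms, of j i]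
    by (metis lessThan_iff less_irrefl linorder_neqE_nat)
qed

lemma card_beta_set: "sorted (rev lam) \<Longrightarrow> card (beta_set lam) = length lam"
  by (simp add: beta_set_def card_image inj_on_beta_num)

lemma sum_lessThan_choose_two: "\<Sum>{..<k} = k choose 2" for k :: nat
  by (induction k) (simp_all add: choose_reduce_nat[of "Suc _" 2] numeral_2_eq_2)

lemma sum_beta_set:
  assumes "sorted (rev lam)"
  shows "\<Sum>(beta_set lam) = sum_list lam + (length lam choose 2)"
proof -
  have "\<Sum>(beta_set lam) = (\<Sum>i<length lam. beta_num lam i)"
    unfolding beta_set_def by (subst sum.reindex[OF inj_on_beta_num[OF assms]]) simp
  also have "\<dots> = (\<Sum>i<length lam. lam ! i) + (\<Sum>i<length lam. length lam - Suc i)"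
    unfolding beta_num_def by (rule sum.distrib)
  also have "(\<Sum>i<length lam. length lam - Suc i) = \<Sum>{..<length lam}"
    by (rule sum.nat_diff_reindex)
  finally show ?thesis
    by (simp add: sum_list_sum_nth sum_lessThan_choose_two[symmetric] lessThan_atLeast0)
qed

text \<open>Deleting the last cell of a row lowers one beta number by 1; the rows where this is
  allowed are those whose next lower place is free.\<close>

lemma corner_rows_beta:
  assumes s: "sorted (rev lam)"
  shows "beta_num lam ` corner_rows lam = {b \<in> beta_set lam. 0 < b \<and> b - 1 \<notin> beta_set lam}"
proof (intro equalityI subsetI)
  fix b assume "b \<in> beta_num lam ` corner_rows lam"
  then obtain i where i: "i \<in> corner_rows lam" "b = beta_num lam i" by auto
  hence len: "i < length lam" "0 < lam ! i" by (auto simp: corner_rows_def)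
  have False if "j < length lam" "beta_num lam j = b - 1" for j
  proof -
    have "beta_num lam j < beta_num lam i" using that i len by (simp add: beta_num_def)
    hence ji: "i < j" using beta_num_less[OF s, of j i] len by (metis less_asym linorder_neqE_nat)
    have "lam ! j \<le> lam ! Suc i" using sorted_rev_nth_mono[OF s, of "Suc i" j] ji that by simp
    moreover have "lam ! Suc i < lam ! i" using i ji that by (auto simp: corner_rows_def)
    ultimately show False using that i ji len by (simp add: beta_num_def)
  qed
  hence "b - 1 \<notin> beta_set lam" unfolding beta_set_def by fastforce
  thus "b \<in> {b \<in> beta_set lam. 0 < b \<and> b - 1 \<notin> beta_set lam}"
    using i len by (auto simp: beta_set_def beta_num_def)
next
  fix b assume b: "b \<in> {b \<in> beta_set lam. 0 < b \<and> b - 1 \<notin> beta_set lam}"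
  then obtain i where i: "i < length lam" "b = beta_num lam i" by (auto simp: beta_set_def)
  have "lam ! Suc i < lam ! i" if "Suc i < length lam"
  proof (rule ccontr)
    assume "\<not> ?thesis"
    hence "lam ! Suc i = lam ! i" using sorted_rev_nth_mono[OF s, of i "Suc i"] that by simp
    hence "beta_num lam (Suc i) = b - 1" using i that by (simp add: beta_num_def)
    hence "b - 1 \<in> beta_set lam" using that unfolding beta_set_def by (metis image_eqI lessThan_iff)
    thus False using b by simp
  qed
  moreover have "0 < lam ! i"
  proof (cases "Suc i < length lam")
    case False
    hence "length lam = Suc i" using i by simp
    thus ?thesis using b i by (auto simp: beta_num_def)
  qed (use calculation in auto)
  ultimately show "b \<in> beta_num lam ` corner_rows lam" using i by (auto simp: corner_rows_def)
qed

lemma beta_set_decr: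
  assumes s: "sorted (rev lam)" and i: "i \<in> corner_rows lam"
  shows "beta_set (decr lam i) = insert (beta_num lam i - 1) (beta_set lam - {beta_num lam i})"
proof -
  have len: "i < length lam" "0 < lam ! i" using i by (auto simp: corner_rows_def)
  have "beta_set (decr lam i) = beta_num (decr lam i) ` insert i ({..<length lam} - {i})"
    using len by (simp add: beta_set_def decr_def insert_absorb)
  also have "\<dots> = insert (beta_num (decr lam i) i) (beta_num lam ` ({..<length lam} - {i}))"
    unfolding image_insert
    by (intro arg_cong2[where f = insert] image_cong) (auto simp: beta_num_def decr_def)
  also have "beta_num (decr lam i) i = beta_num lam i - 1"
    using len by (simp add: beta_num_def decr_def)
  also have "beta_num lam ` ({..<length lam} - {i}) = beta_set lam - {beta_num lam i}"
    using inj_on_image_set_diff[OF inj_on_beta_num[OF s], of "{..<length lam}" "{i}"] len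
    by (simp add: beta_set_def)
  finally show ?thesis .
qed

text \<open>Once the branching rule is multiplied by the factorials, the corner with beta number
  \<open>b\<close> contributes a common factor times \<open>b * shift_coeff B b\<close>, and these
  weights add up to the size of the partition.\<close>

lemma frobenius_degree_formula:
  assumes "sorted (rev lam)"
  shows "f_syt lam * (\<Prod>b\<in>beta_set lam. fact b) = fact (sum_list lam) * gap_prod (beta_set lam)"
  using assms
proof (induction "sum_list lam" arbitrary: lam)
  case 0
  hence "lam ! i = 0" if "i < length lam" for i using that by simp
  hence "beta_set lam = (\<lambda>i. length lam - Suc i) ` {..<length lam}"
    by (auto simp: beta_set_def beta_num_def)
  also have "\<dots> = {..<length lam}"
  proof (intro equalityI subsetI)
    fix x assume "x \<in> {..<length lam}"
    hence "x = length lam - Suc (length lam - Suc x)" "length lam - Suc x \<in> {..<length lam}" by auto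
    thus "x \<in> (\<lambda>i. length lam - Suc i) ` {..<length lam}" by blast
  qed auto
  finally have "beta_set lam = {..<length lam}" .
  moreover have "fact (sum_list lam) = (1 :: nat)" using 0(1) by (metis fact_0)
  ultimately show ?case using 0(1) by (simp only: gap_prod_lessThan f_syt_empty)
next
  case (Suc n)
  note s = \<open>sorted (rev lam)\<close>
  let ?B = "beta_set lam" and ?b = "beta_num lam"
  have step: "real (f_syt (decr lam i) * (\<Prod>b\<in>?B. fact b)) =
      fact n * real (gap_prod ?B) * (real (?b i) * shift_coeff ?B (?b i))"
    if i: "i \<in> corner_rows lam" for i
  proof -
    have b: "?b i \<in> ?B" "0 < ?b i" "?b i - 1 \<notin> ?B" using corner_rows_beta[OF s] i by auto
    have sum: "sum_list (decr lam i) = n" using sum_list_decr[OF i] Suc(2) by simp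
    have "(\<Prod>b\<in>?B. fact b) = fact (?b i) * (\<Prod>b\<in>?B - {?b i}. fact b :: nat)"
      using b by (simp add: prod.remove)
    also have "fact (?b i) = ?b i * fact (?b i - 1)" using b by (simp add: fact_reduce)
    also have "?b i * fact (?b i - 1) * (\<Prod>b\<in>?B - {?b i}. fact b) =
        ?b i * (\<Prod>b\<in>beta_set (decr lam i). fact b)"
      using b by (simp add: beta_set_decr[OF s i])
    finally have "f_syt (decr lam i) * (\<Prod>b\<in>?B. fact b) =
        ?b i * (f_syt (decr lam i) * (\<Prod>b\<in>beta_set (decr lam i). fact b))" by simp
    also have "\<dots> = ?b i * (fact n * gap_prod (beta_set (decr lam i)))"
      using Suc(1)[of "decr lam i"] sum sorted_rev_decr[OF i s] by simp
    finally show ?thesis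
      using gap_prod_lower[OF _ b] by (simp add: beta_set_decr[OF s i])
  qed
  have "real (f_syt lam * (\<Prod>b\<in>?B. fact b)) =
      (\<Sum>i\<in>corner_rows lam. real (f_syt (decr lam i) * (\<Prod>b\<in>?B. fact b)))"
    using Suc(2) by (subst f_syt_branching[OF s]) (auto simp: sum_distrib_right)
  also have "\<dots> = fact n * real (gap_prod ?B) *
      (\<Sum>i\<in>corner_rows lam. real (?b i) * shift_coeff ?B (?b i))"
    by (subst sum_distrib_left, intro sum.cong refl step)
  also have "(\<Sum>i\<in>corner_rows lam. real (?b i) * shift_coeff ?B (?b i)) =
      (\<Sum>b\<in>?b ` corner_rows lam. real b * shift_coeff ?B b)"
    by (subst sum.reindex[OF inj_on_subset[OF inj_on_beta_num[OF s]]]) (auto simp: corner_rows_def)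
  \<comment> \<open>The sum may run over all beta numbers: \<open>b = 0\<close> is killed by the
    factor \<open>b\<close>, and \<open>b - 1\<close> in the set by the factor
    \<open>1 - 1 / 1\<close> of \<open>shift_coeff\<close>.\<close>
  also have "\<dots> = (\<Sum>b\<in>?B. real b * shift_coeff ?B b)"
  proof (rule sum.mono_neutral_left)
    show "\<forall>b\<in>?B - ?b ` corner_rows lam. real b * shift_coeff ?B b = 0"
    proof
      fix b assume "b \<in> ?B - ?b ` corner_rows lam"
      hence "b = 0 \<or> (0 < b \<and> b - 1 \<in> ?B)" unfolding corner_rows_beta[OF s] by auto
      thus "real b * shift_coeff ?B b = 0"
      proof
        assume b: "0 < b \<and> b - 1 \<in> ?B"
        hence "1 - 1 / (real b - real (b - 1)) = 0" by (simp add: of_nat_diff)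
        moreover have "b - 1 \<in> ?B - {b}" using b by auto
        ultimately show ?thesis unfolding shift_coeff_def
          by (metis (no_types, lifting) finite_beta_set finite_Diff mult_eq_0_iff prod_zero)
      qed simp
    qed
  qed (auto simp: corner_rows_beta[OF s])
  also have "\<dots> = real (Suc n)"
    using sum_beta_set[OF s] card_beta_set[OF s] Suc(2) by (simp add: sum_mult_shift_coeff)
  finally have "real (f_syt lam * (\<Prod>b\<in>?B. fact b)) = real (fact (Suc n) * gap_prod ?B)"
    by (simp add: algebra_simps)
  thus ?case using Suc(2) by (metis of_nat_eq_iff)
qed

subsection \<open>Valuations of beta sets\<close>

abbreviation v2 :: "nat \<Rightarrow> nat" where
  "v2 \<equiv> multiplicity 2"

lemma v2_mult: "0 < x \<Longrightarrow> 0 < y \<Longrightarrow> v2 (x * y) = v2 x + v2 y"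
  by (rule prime_elem_multiplicity_mult_distrib) auto

lemma v2_prod: "(\<And>x. x \<in> A \<Longrightarrow> 0 < f x) \<Longrightarrow> v2 (prod f A) = (\<Sum>x\<in>A. v2 (f x))"
  by (induction A rule: infinite_finite_induct) (auto simp: v2_mult prod_pos)

lemma v2_double: "0 < x \<Longrightarrow> v2 (2 * x) = Suc (v2 x)"
  by (rule multiplicity_times_same) auto

lemma v2_eq_0_iff: "0 < x \<Longrightarrow> v2 x = 0 \<longleftrightarrow> odd x"
  by (rule multiplicity_eq_zero_iff) auto

lemma v2_odd: "odd x \<Longrightarrow> v2 x = 0"
  by (rule not_dvd_imp_multiplicity_0)

lemma v2_eq_1_iff:
  assumes "0 < x"
  shows "v2 x = 1 \<longleftrightarrow> x mod 4 = 2"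
proof (cases "even x")
  case True
  then obtain y where y: "x = 2 * y" by blast
  hence "v2 x = 1 \<longleftrightarrow> v2 y = 0" using assms v2_double[of y] by auto
  also have "\<dots> \<longleftrightarrow> odd y" using assms y by (intro v2_eq_0_iff) auto
  also have "\<dots> \<longleftrightarrow> x mod 4 = 2" unfolding y by presburger
  finally show ?thesis .
next
  case False
  hence "v2 x = 0" by (rule v2_odd)
  moreover have "x mod 4 \<noteq> 2" using False by presburger
  ultimately show ?thesis by simp
qed

lemma v2_fact_double: "v2 (fact (2 * x)) = x + v2 (fact x)"
proof (induction x)
  case (Suc x)
  have "fact (2 * Suc x) = (2 * Suc x) * (Suc (2 * x) * fact (2 * x) :: nat)"
    by (simp add: algebra_simps)
  hence "v2 (fact (2 * Suc x)) = Suc (v2 (Suc x)) + v2 (fact (2 * x))"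
    using v2_mult[of "2 * Suc x" "Suc (2 * x) * fact (2 * x)"] v2_mult[of "Suc (2 * x)" "fact (2 * x)"]
      v2_double[of "Suc x"] v2_odd[of "Suc (2 * x)"]
    by (simp del: fact_Suc mult_Suc mult_Suc_right)
  also have "\<dots> = Suc x + (v2 (Suc x) + v2 (fact x))" using Suc by simp
  also have "\<dots> = Suc x + v2 (fact (Suc x))"
    using v2_mult[of "Suc x" "fact x"] by simp
  finally show ?case .
qed simp

lemma v2_fact_Suc_double: "v2 (fact (Suc (2 * x))) = x + v2 (fact x)"
  using v2_mult[of "Suc (2 * x)" "fact (2 * x)"] v2_odd[of "Suc (2 * x)"]
  by (simp add: v2_fact_double)

lemma v2_fact: "v2 (fact n) = n div 2 + v2 (fact (n div 2))"
proof (cases "even n")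
  case True
  thus ?thesis using v2_fact_double[of "n div 2"] by simp
next
  case False
  thus ?thesis using v2_fact_Suc_double[of "n div 2"] by simp
qed

lemma v2_gap_prod: "v2 (gap_prod S) = (\<Sum>(x, y)\<in>gap_pairs S. v2 (y - x))"
  unfolding gap_prod_def by (subst v2_prod) (auto simp: gap_pairs_def case_prod_beta)

section \<open>Even and odd runners of the 2-abacus\<close>

definition interleave :: "nat set \<Rightarrow> nat set \<Rightarrow> nat set" where
  "interleave X Y = (\<lambda>x. 2 * x) ` X \<union> (\<lambda>y. Suc (2 * y)) ` Y"

lemma interleave_disjoint: "(\<lambda>x. 2 * x) ` X \<inter> (\<lambda>y. Suc (2 * y)) ` Y = ({} :: nat set)"
  by auto presburger

lemma finite_interleave [simp]: "finite X \<Longrightarrow> finite Y \<Longrightarrow> finite (interleave X Y)"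
  by (simp add: interleave_def)

lemma sum_interleave:
  assumes "finite X" "finite Y"
  shows "(\<Sum>b\<in>interleave X Y. f b) = (\<Sum>x\<in>X. f (2 * x)) + (\<Sum>y\<in>Y. f (Suc (2 * y)))"
proof -
  have "(\<Sum>b\<in>interleave X Y. f b) =
      (\<Sum>b\<in>(\<lambda>x. 2 * x) ` X. f b) + (\<Sum>b\<in>(\<lambda>y. Suc (2 * y)) ` Y. f b)"
    unfolding interleave_def using assms interleave_disjoint by (intro sum.union_disjoint) auto
  thus ?thesis by (simp add: sum.reindex inj_on_def)
qed

lemma card_interleave: "finite X \<Longrightarrow> finite Y \<Longrightarrow> card (interleave X Y) = card X + card Y"
  using sum_interleave[of X Y "\<lambda>_. 1 :: nat"] by simp

lemma interleave_inj: "interleave X Y = interleave X' Y' \<Longrightarrow> X = X' \<and> Y = Y'"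
proof -
  have "X = {x. 2 * x \<in> interleave X Y}" "Y = {y. Suc (2 * y) \<in> interleave X Y}" for X Y
    by (auto simp: interleave_def) presburger+
  thus "interleave X Y = interleave X' Y' \<Longrightarrow> X = X' \<and> Y = Y'" by metis
qed

lemma interleave_surj:
  assumes "finite B"
  obtains X Y where "finite X" "finite Y" "B = interleave X Y"
proof
  show "finite {x. 2 * x \<in> B}" "finite {y. Suc (2 * y) \<in> B}"
    using finite_vimageI[OF assms, of "\<lambda>x. 2 * x"] finite_vimageI[OF assms, of "\<lambda>x. Suc (2 * x)"]
    by (simp_all add: vimage_def inj_on_def)
  show "B = interleave {x. 2 * x \<in> B} {y. Suc (2 * y) \<in> B}"
  proof (intro equalityI subsetI)
    fix b assume "b \<in> B"
    thus "b \<in> interleave {x. 2 * x \<in> B} {y. Suc (2 * y) \<in> B}"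
      by (cases "even b") (auto simp: interleave_def elim!: evenE oddE)
  qed (auto simp: interleave_def)
qed

text \<open>Pairs of opposite parity have odd difference and contribute nothing. Each pair of equal
  parity has a doubled difference and adds 1, which produces the binomial coefficients.\<close>

lemma v2_gap_prod_interleave:
  assumes "finite X" "finite Y"
  shows "v2 (gap_prod (interleave X Y)) =
    (card X choose 2) + v2 (gap_prod X) + ((card Y choose 2) + v2 (gap_prod Y))"
proof -
  let ?e = "map_prod (\<lambda>x. 2 * x) (\<lambda>x. 2 * x) :: nat \<times> nat \<Rightarrow> nat \<times> nat"
  let ?o = "map_prod (\<lambda>x. Suc (2 * x)) (\<lambda>x. Suc (2 * x)) :: nat \<times> nat \<Rightarrow> nat \<times> nat"
  let ?E = "?e ` gap_pairs X" and ?O = "?o ` gap_pairs Y"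
  let ?f = "\<lambda>(x, y). v2 (y - x)"
  have inj: "inj_on ?e A" "inj_on ?o A" for A by (auto simp: inj_on_def)
  have even_part: "(\<Sum>p\<in>?E. ?f p) = (card X choose 2) + v2 (gap_prod X)"
  proof -
    have "(\<Sum>p\<in>?E. ?f p) = (\<Sum>p\<in>gap_pairs X. Suc (?f p))"
      using v2_double by (subst sum.reindex[OF inj(1)])
        (auto simp: gap_pairs_def diff_mult_distrib2[symmetric] intro!: sum.cong)
    also have "\<dots> = card (gap_pairs X) + v2 (gap_prod X)"
      by (simp add: sum_Suc v2_gap_prod)
    finally show ?thesis using assms by (simp add: card_gap_pairs)
  qed
  have odd_part: "(\<Sum>p\<in>?O. ?f p) = (card Y choose 2) + v2 (gap_prod Y)"
  proof -
    have "(\<Sum>p\<in>?O. ?f p) = (\<Sum>p\<in>gap_pairs Y. Suc (?f p))"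
      using v2_double by (subst sum.reindex[OF inj(2)])
        (auto simp: gap_pairs_def diff_mult_distrib2[symmetric] intro!: sum.cong)
    also have "\<dots> = card (gap_pairs Y) + v2 (gap_prod Y)"
      by (simp add: sum_Suc v2_gap_prod)
    finally show ?thesis using assms by (simp add: card_gap_pairs)
  qed
  have "(\<Sum>p\<in>gap_pairs (interleave X Y). ?f p) = (\<Sum>p\<in>?E \<union> ?O. ?f p)"
  proof (rule sum.mono_neutral_right)
    show "?E \<union> ?O \<subseteq> gap_pairs (interleave X Y)" by (auto simp: gap_pairs_def interleave_def)
    show "\<forall>p\<in>gap_pairs (interleave X Y) - (?E \<union> ?O). ?f p = 0"
    proof
      fix p assume p: "p \<in> gap_pairs (interleave X Y) - (?E \<union> ?O)"
      obtain x y where xy: "p = (x, y)" by (cases p)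
      have "odd (y - x)"
      proof (rule ccontr)
        assume "\<not> odd (y - x)"
        hence parity: "even x \<longleftrightarrow> even y" using p xy by (auto simp: gap_pairs_def)
        show False
        proof (cases "even x")
          case True
          then obtain a b where "x = 2 * a" "y = 2 * b" using parity by (auto elim!: evenE)
          moreover have "a \<in> X" "b \<in> X" using p xy calculation
            by (auto simp: gap_pairs_def interleave_def) presburger+
          ultimately have "p = ?e (a, b)" "(a, b) \<in> gap_pairs X"
            using p xy by (auto simp: gap_pairs_def)
          thus False using p by blast
        next
          case False
          then obtain a b where "x = Suc (2 * a)" "y = Suc (2 * b)" using parity by (auto elim!: oddE)
          moreover have "a \<in> Y" "b \<in> Y" using p xy calculation
            by (auto simp: gap_pairs_def interleave_def) presburger+
          ultimately have "p = ?o (a, b)" "(a, b) \<in> gap_pairs Y"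
            using p xy by (auto simp: gap_pairs_def)
          thus False using p by blast
        qed
      qed
      thus "?f p = 0" using xy by (simp add: v2_odd)
    qed
  qed (use assms in auto)
  also have "\<dots> = (\<Sum>p\<in>?E. ?f p) + (\<Sum>p\<in>?O. ?f p)"
  proof (rule sum.union_disjoint)
    show "?E \<inter> ?O = {}" by auto presburger
  qed (use assms in auto)
  finally show ?thesis by (simp add: even_part odd_part v2_gap_prod)
qed

section \<open>Size and hook valuation of a beta set\<close>

definition beta_weight :: "nat set \<Rightarrow> int" where
  "beta_weight B = int (\<Sum>B) - int (card B choose 2)"

text \<open>The valuation of the product of all hook lengths, which is the product of the factorials
  divided by the product of the gaps.\<close>

definition hook_val :: "nat set \<Rightarrow> int" where
  "hook_val B = (\<Sum>b\<in>B. int (v2 (fact b))) - int (v2 (gap_prod B))"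

text \<open>The factorials yield the element sums of X and Y and the gaps yield the binomials of
  their sizes; together these are the two weights.\<close>

lemma hook_val_interleave:
  assumes "finite X" "finite Y"
  shows "hook_val (interleave X Y) = beta_weight X + beta_weight Y + hook_val X + hook_val Y"
  unfolding hook_val_def sum_interleave[OF assms] v2_gap_prod_interleave[OF assms]
  by (simp only: v2_fact_double v2_fact_Suc_double) (simp add: beta_weight_def sum.distrib)

text \<open>
  Pairs with \<open>card X = c + e\<close> and \<open>card Y = c - e\<close> belong to 2-cores of this triangular size.
\<close>

definition core_size :: "int \<Rightarrow> int" where
  "core_size e = e * (2 * e - 1)"

lemma int_choose_two: "2 * int (n choose 2) = int n * (int n - 1)"
  by (induction n) (simp_all add: choose_reduce_nat[of "Suc _" 2] numeral_2_eq_2 algebra_simps)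

text \<open>Macdonald's relation: a partition is twice its 2-quotient plus its 2-core in size, and
  the core depends only on the imbalance of the runners.\<close>

lemma beta_weight_interleave:
  assumes "finite X" "finite Y" "int (card X) = c + e" "int (card Y) = c - e"
  shows "beta_weight (interleave X Y) = 2 * (beta_weight X + beta_weight Y) + core_size e"
proof -
  have "int (card X) + int (card Y) = 2 * c" using assms by simp
  \<comment> \<open>The binomials are doubled so that the comparison becomes polynomial over the
    integers.\<close>
  hence "2 * int ((card X + card Y) choose 2) = 2 * c * (2 * c - 1)"
    unfolding int_choose_two by simp
  moreover have "2 * int (card X choose 2) = (c + e) * (c + e - 1)"
    "2 * int (card Y choose 2) = (c - e) * (c - e - 1)"
    unfolding int_choose_two assms by simp_all
  moreover have "int (\<Sum>(interleave X Y)) = 2 * int (\<Sum>X) + 2 * int (\<Sum>Y) + (c - e)"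
    using assms(1,2) by (simp add: sum_interleave sum.distrib sum_distrib_left assms(4)[symmetric])
  ultimately show ?thesis
    using assms(1,2) by (simp add: beta_weight_def card_interleave core_size_def algebra_simps)
qed

subsection \<open>Partitions as beta sets\<close>

text \<open>Ensures that subtracting the staircase from an increasing list neither truncates at 0
  nor destroys monotonicity.\<close>

lemma strict_sorted_nth_gap:
  fixes xs :: "nat list"
  assumes "sorted_wrt (<) xs" "i \<le> j" "j < length xs"
  shows "xs ! i + (j - i) \<le> xs ! j"
  using assms(2,3)
proof (induction j rule: dec_induct)
  case (step j)
  moreover have "xs ! j < xs ! Suc j"
    using assms(1) step.prems by (simp add: sorted_wrt_nth_less)
  ultimately show ?case by simp
qed simp

lemma ex_beta_set:
  assumes "finite B"
  obtains lam where "sorted (rev lam)" "length lam = card B" "beta_set lam = B"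
proof -
  define k where "k = card B"
  define xs where "xs = sorted_list_of_set B"
  have xs: "sorted_wrt (<) xs" "set xs = B" "length xs = k"
    using assms by (simp_all add: xs_def k_def)
  \<comment> \<open>The inverse of \<open>beta_num\<close>: take the elements in decreasing order
    and subtract the staircase.\<close>
  define lam where "lam = map (\<lambda>i. xs ! (k - Suc i) - (k - Suc i)) [0..<k]"
  have nth: "lam ! i = xs ! (k - Suc i) - (k - Suc i)" "k - Suc i \<le> xs ! (k - Suc i)" if "i < k" for i
    using strict_sorted_nth_gap[OF xs(1), of 0 "k - Suc i"] that xs(3) by (simp_all add: lam_def)
  have "lam ! j \<le> lam ! i" if ij: "i \<le> j" "j < k" for i j
  proof -
    have "xs ! (k - Suc j) + ((k - Suc i) - (k - Suc j)) \<le> xs ! (k - Suc i)"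
      using ij xs(3) by (intro strict_sorted_nth_gap[OF xs(1)]) auto
    thus ?thesis using nth(1)[of i] nth(1)[of j] ij by linarith
  qed
  hence "sorted (rev lam)" by (simp add: sorted_rev_iff_nth_mono lam_def)
  moreover have "beta_set lam = B"
  proof -
    have "beta_num lam i = xs ! (k - Suc i)" if "i < k" for i
      using nth[OF that] by (simp add: beta_num_def lam_def)
    hence "beta_set lam = (\<lambda>i. xs ! (k - Suc i)) ` {..<k}"
      by (simp add: beta_set_def lam_def)
    also have "\<dots> = (!) xs ` (\<lambda>i. k - Suc i) ` {..<k}" by (simp add: image_image)
    also have "(\<lambda>i. k - Suc i) ` {..<k} = {..<k}"
    proof (intro equalityI subsetI)
      fix i assume "i \<in> {..<k}"
      hence "i = k - Suc (k - Suc i)" "k - Suc i \<in> {..<k}" by auto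
      thus "i \<in> (\<lambda>i. k - Suc i) ` {..<k}" by blast
    qed auto
    finally show ?thesis using xs by (auto simp: set_conv_nth)
  qed
  ultimately show thesis using that by (simp add: lam_def k_def)
qed

text \<open>Beta numbers strictly decrease along the rows, so sorting the set recovers them in
  order.\<close>

lemma beta_set_inj:
  assumes "sorted (rev lam)" "sorted (rev mu)" "length lam = length mu" "beta_set lam = beta_set mu"
  shows "lam = mu"
proof -
  have sorted_beta: "rev (map (beta_num l) [0..<length l]) = sorted_list_of_set (beta_set l)"
    if "sorted (rev l)" for l
  proof -
    have "sorted_wrt (<) (rev (map (beta_num l) [0..<length l]))"
      using beta_num_less[OF that] by (subst sorted_wrt_rev) (simp add: sorted_wrt_iff_nth_less)
    moreover have "set (rev (map (beta_num l) [0..<length l])) = beta_set l"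
      by (auto simp: beta_set_def)
    ultimately show ?thesis
      by (metis sorted_list_of_set.idem_if_sorted_distinct strict_sorted_iff)
  qed
  have eq: "map (beta_num lam) [0..<length lam] = map (beta_num mu) [0..<length mu]"
    using sorted_beta[OF assms(1)] sorted_beta[OF assms(2)] assms(4) by (metis rev_is_rev_conv)
  show ?thesis
  proof (rule nth_equalityI)
    fix i assume "i < length lam"
    hence "beta_num lam i = beta_num mu i" using eq assms(3) by simp
    thus "lam ! i = mu ! i" using assms(3) by (simp add: beta_num_def)
  qed (rule assms(3))
qed

text \<open>Encodes the partitions of \<open>n\<close> with at most \<open>k\<close> parts, filled
  up with zero rows to exactly \<open>k\<close> rows.\<close>

definition beta_sets :: "nat \<Rightarrow> nat \<Rightarrow> nat set set" where
  "beta_sets n k = {B. finite B \<and> card B = k \<and> \<Sum>B = n + (k choose 2)}"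

text \<open>A formula in the set alone, so that it can be applied to X and Y separately; it is the
  valuation of a degree when \<open>B\<close> encodes a partition of \<open>n\<close>.\<close>

definition degree_val :: "nat \<Rightarrow> nat set \<Rightarrow> int" where
  "degree_val n B = int (v2 (fact n)) - hook_val B"

lemma finite_beta_sets [simp]: "finite (beta_sets n k)"
proof (rule finite_subset)
  show "beta_sets n k \<subseteq> Pow {..n + (k choose 2)}"
  proof
    fix B assume "B \<in> beta_sets n k"
    hence "finite B" "\<Sum>B = n + (k choose 2)" by (auto simp: beta_sets_def)
    thus "B \<in> Pow {..n + (k choose 2)}" using member_le_sum[of _ B "\<lambda>b. b"] by fastforce
  qed
qed simp

lemma f_syt_pos: "sorted (rev lam) \<Longrightarrow> 0 < f_syt lam"
  using frobenius_degree_formula[of lam] gap_prod_pos[of "beta_set lam"]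
  by (metis finite_beta_set fact_nonzero gr0I mult_eq_0_iff mult_zero_left)

lemma degree_val_eq:
  assumes "sorted (rev lam)"
  shows "degree_val (sum_list lam) (beta_set lam) = int (v2 (f_syt lam))"
proof -
  have "v2 (f_syt lam * (\<Prod>b\<in>beta_set lam. fact b)) =
      v2 (f_syt lam) + (\<Sum>b\<in>beta_set lam. v2 (fact b))"
    using f_syt_pos[OF assms] by (subst v2_mult) (auto simp: v2_prod prod_pos)
  moreover have "v2 (fact (sum_list lam) * gap_prod (beta_set lam)) =
      v2 (fact (sum_list lam)) + v2 (gap_prod (beta_set lam))"
    by (rule v2_mult) (simp_all add: gap_prod_pos)
  ultimately have "int (v2 (f_syt lam)) + (\<Sum>b\<in>beta_set lam. int (v2 (fact b))) =
      int (v2 (fact (sum_list lam))) + int (v2 (gap_prod (beta_set lam)))"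
    using frobenius_degree_formula[OF assms] by (simp flip: of_nat_add of_nat_sum)
  thus ?thesis by (simp add: degree_val_def hook_val_def)
qed

lemma beta_weight_beta_set: "sorted (rev lam) \<Longrightarrow> beta_weight (beta_set lam) = int (sum_list lam)"
  by (simp add: beta_weight_def card_beta_set sum_beta_set del: of_nat_sum)

lemma beta_sets_iff:
  "B \<in> beta_sets n k \<longleftrightarrow> finite B \<and> card B = k \<and> beta_weight B = int n"
  by (auto simp: beta_sets_def beta_weight_def simp del: of_nat_sum)

text \<open>Every finite set is the beta set of some partition, whose size is the weight.\<close>

lemma beta_weight_nonneg: "finite B \<Longrightarrow> 0 \<le> beta_weight B"
  by (metis ex_beta_set beta_weight_beta_set of_nat_0_le_iff)

lemma degree_val_nonneg:
  assumes "B \<in> beta_sets n k"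
  shows "0 \<le> degree_val n B"
proof -
  have "finite B" using assms by (simp add: beta_sets_iff)
  then obtain lam where lam: "sorted (rev lam)" "beta_set lam = B"
    using ex_beta_set[of B] by blast
  hence "sum_list lam = n" using beta_weight_beta_set[of lam] assms by (simp add: beta_sets_iff)
  thus ?thesis using degree_val_eq lam by fastforce
qed

section \<open>Padding partitions with zero rows\<close>

definition pad :: "nat \<Rightarrow> nat list \<Rightarrow> nat list" where
  "pad k lam = lam @ replicate (k - length lam) 0"

lemma sum_list_pad [simp]: "sum_list (pad k lam) = sum_list lam"
  by (simp add: pad_def)

lemma length_pad: "length lam \<le> k \<Longrightarrow> length (pad k lam) = k"
  by (simp add: pad_def)

lemma sorted_rev_pad: "sorted (rev lam) \<Longrightarrow> sorted (rev (pad k lam))"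
  by (auto simp: pad_def sorted_append)

lemma f_syt_pad: "f_syt (pad k lam) = f_syt lam"
proof -
  have "cells (pad k lam) = cells lam"
    by (auto simp: cells_def pad_def nth_append split: if_splits)
  thus ?thesis by (simp add: f_syt_def SYT_def)
qed

lemma filter_pos_pad: "0 \<notin> set lam \<Longrightarrow> filter ((<) 0) (pad k lam) = lam"
  by (auto simp: pad_def filter_id_conv intro!: gr0I)

text \<open>In a weakly decreasing list the zeros form a tail.\<close>

lemma pad_filter_pos:
  assumes "sorted (rev lam)"
  shows "pad (length lam) (filter ((<) 0) lam) = lam"
  using assms
proof (induction lam)
  case (Cons x lam)
  show ?case
  proof (cases "x = 0")
    case True
    hence "set lam \<subseteq> {0}" using Cons.prems by (auto simp: sorted_append)
    hence "lam = replicate (length lam) 0" by (metis replicate_eqI singletonD subsetD)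
    hence "filter ((<) 0) lam = []" by (metis filter_False in_set_replicate less_irrefl)
    thus ?thesis using True \<open>lam = replicate (length lam) 0\<close> by (simp add: pad_def)
  next
    case False
    thus ?thesis using Cons by (simp add: pad_def sorted_append)
  qed
qed (simp add: pad_def)

lemma sum_list_filter_pos: "sum_list (filter ((<) 0) lam) = sum_list (lam :: nat list)"
  by (induction lam) auto

lemma length_le_sum_list: "0 \<notin> set lam \<Longrightarrow> length lam \<le> sum_list (lam :: nat list)"
  by (induction lam) auto

text \<open>A partition of \<open>n\<close> has at most \<open>n\<close> parts, so
  \<open>k \<ge> n\<close> rows leave room for all of them.\<close>

lemma bij_betw_beta_sets:
  assumes "n \<le> k"
  shows "bij_betw (\<lambda>lam. beta_set (pad k lam)) (partitions n) (beta_sets n k)"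
proof (rule bij_betwI')
  have len: "length lam \<le> k" if "lam \<in> partitions n" for lam
    using length_le_sum_list[of lam] that assms by (simp add: partitions_def)
  show "beta_set (pad k lam) = beta_set (pad k mu) \<longleftrightarrow> lam = mu"
    if lm: "lam \<in> partitions n" "mu \<in> partitions n" for lam mu
  proof
    assume "beta_set (pad k lam) = beta_set (pad k mu)"
    hence "pad k lam = pad k mu"
      using lm len by (intro beta_set_inj) (auto simp: sorted_rev_pad length_pad partitions_def)
    thus "lam = mu" using lm filter_pos_pad by (metis (mono_tags, lifting) mem_Collect_eq partitions_def)
  qed simp
  show "beta_set (pad k lam) \<in> beta_sets n k" if "lam \<in> partitions n" for lam
  proof -
    have "sorted (rev (pad k lam))" using that by (simp add: partitions_def sorted_rev_pad)
    thus ?thesis using that len[OF that]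
      by (simp add: beta_sets_iff card_beta_set beta_weight_beta_set length_pad partitions_def)
  qed
  show "\<exists>lam\<in>partitions n. B = beta_set (pad k lam)" if "B \<in> beta_sets n k" for B
  proof -
    have "finite B" "card B = k" using that by (auto simp: beta_sets_iff)
    then obtain lam where lam: "sorted (rev lam)" "length lam = k" "beta_set lam = B"
      using ex_beta_set[of B] by blast
    hence "sum_list lam = n" using beta_weight_beta_set[of lam] that by (simp add: beta_sets_iff)
    hence "filter ((<) 0) lam \<in> partitions n"
      using lam by (simp add: partitions_def sum_list_filter_pos sorted_wrt_filter rev_filter)
    thus ?thesis using pad_filter_pos[OF lam(1)] lam by metis
  qed
qed

lemma card_partitions_degree:
  assumes "n \<le> k" and "\<And>x. 0 < x \<Longrightarrow> P x \<longleftrightarrow> int (v2 x) = j"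
  shows "card {lam \<in> partitions n. P (f_syt lam)} = card {B \<in> beta_sets n k. degree_val n B = j}"
proof -
  have "degree_val n (beta_set (pad k lam)) = int (v2 (f_syt lam))" "0 < f_syt lam"
    if "lam \<in> partitions n" for lam
    using degree_val_eq[of "pad k lam"] f_syt_pos[of lam] that
    by (simp_all add: partitions_def sorted_rev_pad f_syt_pad)
  hence "{B \<in> beta_sets n k. degree_val n B = j} =
      (\<lambda>lam. beta_set (pad k lam)) ` {lam \<in> partitions n. P (f_syt lam)}"
    unfolding bij_betw_imp_surj_on[OF bij_betw_beta_sets[OF assms(1)], symmetric]
    using assms(2) by auto
  moreover have "inj_on (\<lambda>lam. beta_set (pad k lam)) {lam \<in> partitions n. P (f_syt lam)}"
    by (rule inj_on_subset[OF bij_betw_imp_inj_on[OF bij_betw_beta_sets[OF assms(1)]]]) auto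
  ultimately show ?thesis by (simp add: card_image)
qed

lemma finite_partitions: "finite (partitions n)"
  using bij_betw_finite[OF bij_betw_beta_sets[OF order_refl]] by simp

text \<open>Valid for every \<open>k \<ge> n\<close>, which allows the two runners to carry
  different numbers of elements.\<close>

lemma a_odd_beta_sets:
  assumes "n \<le> k"
  shows "a_odd n = card {B \<in> beta_sets n k. degree_val n B = 0}"
proof -
  have "a_odd n = card ({lam \<in> partitions n. f_syt lam mod 4 = 1} \<union> {lam \<in> partitions n. f_syt lam mod 4 = 3})"
    unfolding a_odd_def a_mod4_def using finite_partitions by (subst card_Un_disjoint) auto
  also have "\<dots> = card {lam \<in> partitions n. odd (f_syt lam)}"
    by (rule arg_cong[where f = card]) (auto, presburger+)
  also have "\<dots> = card {B \<in> beta_sets n k. degree_val n B = 0}"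
    using assms by (rule card_partitions_degree) (simp add: v2_eq_0_iff)
  finally show ?thesis .
qed

lemma a_mod4_2_beta_sets:
  assumes "n \<le> k"
  shows "a_mod4 2 n = card {B \<in> beta_sets n k. degree_val n B = 1}"
  unfolding a_mod4_def using assms
  by (rule card_partitions_degree) (use v2_eq_1_iff in auto)

subsection \<open>Recurrences for the counting functions\<close>

lemma v2_fact_add: "v2 (fact (a + b)) = v2 (fact a) + v2 (fact b) + v2 ((a + b) choose a)"
proof -
  have "fact (a + b) = fact a * fact b * ((a + b) choose a :: nat)"
    using binomial_fact_lemma[of a "a + b"] by simp
  thus ?thesis using v2_mult[of "fact a * fact b" "(a + b) choose a"] v2_mult[of "fact a" "fact b"]
    by simp
qed

text \<open>Here \<open>u\<close> is the size of the partition encoded by \<open>X\<close>, and the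
  binomial coefficient is the number of ways to distribute \<open>s\<close> labels between the two
  parts of the quotient.\<close>

definition beta_pairs :: "nat \<Rightarrow> nat \<Rightarrow> nat \<Rightarrow> int \<Rightarrow> (nat set \<times> nat set) set" where
  "beta_pairs s p q j = {(X, Y). \<exists>u\<le>s. X \<in> beta_sets u p \<and> Y \<in> beta_sets (s - u) q \<and>
     int (v2 (s choose u)) + degree_val u X + degree_val (s - u) Y = j}"

text \<open>The shift of \<open>j\<close> is the contribution of the core: it is 0 for cores of size
  0 and 1, and \<open>1 + v2 (s + 1)\<close> for size 3.\<close>

lemma interleave_in_beta_sets_iff:
  assumes X: "finite X" and Y: "finite Y" and "int p = c + e" "int q = c - e" "int k = 2 * c"
    and n: "int n = 2 * int s + core_size e"
  shows "interleave X Y \<in> beta_sets n k \<and> card X = p \<and> degree_val n (interleave X Y) = j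
    \<longleftrightarrow> (X, Y) \<in> beta_pairs s p q (j - (int (v2 (fact n)) - int s - int (v2 (fact s))))"
    (is "?L \<longleftrightarrow> ?R")
proof -
  have dv: "degree_val n (interleave X Y) = int (v2 (fact n)) - int s - int (v2 (fact s))
      + (int (v2 (s choose u)) + degree_val u X + degree_val (s - u) Y)"
    if "u \<le> s" "beta_weight X = int u" "beta_weight Y = int (s - u)" for u
    using that v2_fact_add[of u "s - u"] X Y by (simp add: degree_val_def hook_val_interleave)
  show ?thesis
  proof
    assume L: ?L
    hence card: "int (card X) = c + e" "int (card Y) = c - e"
      using assms card_interleave[OF X Y] by (auto simp: beta_sets_iff)
    have "int n = 2 * (beta_weight X + beta_weight Y) + core_size e"
      using L beta_weight_interleave[OF X Y card] by (simp add: beta_sets_iff)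
    hence s: "int s = beta_weight X + beta_weight Y" using n by simp
    define u where "u = nat (beta_weight X)"
    have u: "u \<le> s" "beta_weight X = int u" "beta_weight Y = int (s - u)"
      using s beta_weight_nonneg[OF X] beta_weight_nonneg[OF Y] by (auto simp: u_def)
    thus ?R using L dv[OF u] X Y card assms by (auto simp: beta_pairs_def beta_sets_iff)
  next
    assume ?R
    then obtain u where u: "u \<le> s" "X \<in> beta_sets u p" "Y \<in> beta_sets (s - u) q"
      "int (v2 (s choose u)) + degree_val u X + degree_val (s - u) Y =
        j - (int (v2 (fact n)) - int s - int (v2 (fact s)))"
      by (auto simp: beta_pairs_def)
    hence w: "beta_weight X = int u" "beta_weight Y = int (s - u)"
      and card: "int (card X) = c + e" "int (card Y) = c - e" using assms by (auto simp: beta_sets_iff)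
    have "card (interleave X Y) = k" using card assms card_interleave[OF X Y] by linarith
    moreover have "beta_weight (interleave X Y) = int n"
      using beta_weight_interleave[OF X Y card] w n u(1) by simp
    ultimately show ?L using dv[OF u(1) w] u X Y by (simp add: beta_sets_iff)
  qed
qed

text \<open>The values are the triangular numbers 0, 1, 3, 6, 10 and so on, so the bound 5 keeps
  just the sizes 0, 1 and 3.\<close>

lemma core_size_cases: "core_size e \<le> 5 \<Longrightarrow> e = 0 \<or> e = 1 \<or> e = -1"
proof (rule ccontr)
  assume e: "core_size e \<le> 5" "\<not> (e = 0 \<or> e = 1 \<or> e = -1)"
  hence "2 \<le> e \<or> e \<le> -2" by linarith
  thus False
  proof
    assume "2 \<le> e"
    hence "2 * 3 \<le> e * (2 * e - 1)" by (intro mult_mono) auto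
    thus False using e by (simp add: core_size_def)
  next
    assume "e \<le> -2"
    hence "2 * 5 \<le> (- e) * (1 - 2 * e)" by (intro mult_mono) auto
    thus False using e by (simp add: core_size_def algebra_simps)
  qed
qed

text \<open>A core of size at least 6 makes \<open>n\<close> exceed \<open>2 * (u + w)\<close> by 6
  or more, so \<open>n!\<close> contains three more factors 2 than the hooks can cancel and the
  valuation is at least 3.\<close>

lemma degree_val_large_core:
  assumes X: "finite X" and Y: "finite Y" and k: "int k = 2 * c"
    and e: "int (card X) = c + e"
    and B: "interleave X Y \<in> beta_sets n k" "degree_val n (interleave X Y) \<le> 1"
  shows "e = 0 \<or> e = 1 \<or> e = -1"
proof (rule core_size_cases, rule ccontr)
  assume "\<not> core_size e \<le> 5"
  moreover have cY: "int (card Y) = c - e"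
    using B e k card_interleave[OF X Y] by (auto simp: beta_sets_iff)
  define u where "u = nat (beta_weight X)"
  define w where "w = nat (beta_weight Y)"
  have uw: "beta_weight X = int u" "beta_weight Y = int w"
    using beta_weight_nonneg[OF X] beta_weight_nonneg[OF Y] by (auto simp: u_def w_def)
  have "int n = 2 * (int u + int w) + core_size e"
    using beta_weight_interleave[OF X Y e cY] B uw by (simp add: beta_sets_iff)
  ultimately have "int (2 * (u + w + 3)) \<le> int n" by simp
  hence "2 * (u + w + 3) \<le> n" by (simp only: of_nat_le_iff)
  then obtain r where r: "n = 2 * (u + w + 3) + r" using le_Suc_ex by blast
  have "u + w + 3 + v2 (fact u) + v2 (fact w) \<le> v2 (fact n)"
    unfolding r using v2_fact_add[of "2 * (u + w + 3)" r] v2_fact_add[of "u + w" 3] v2_fact_add[of u w]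
      v2_fact_double[of "u + w + 3"] by simp
  moreover have "0 \<le> degree_val u X" "0 \<le> degree_val w Y"
    using degree_val_nonneg[of X u "card X"] degree_val_nonneg[of Y w "card Y"] X Y uw
    by (simp_all add: beta_sets_iff)
  ultimately show False
    using B(2) by (simp add: degree_val_def hook_val_interleave[OF X Y] uw)
qed

lemma beta_pairs_finite: "(X, Y) \<in> beta_pairs s p q j \<Longrightarrow> finite X \<and> finite Y \<and> card X = p"
  by (auto simp: beta_pairs_def beta_sets_iff)

lemma inj_on_interleave: "inj_on (case_prod interleave) A"
  by (auto simp: inj_on_def dest: interleave_inj)

lemma beta_sets_even:
  assumes "j \<le> 1"
  shows "{B \<in> beta_sets (2 * s) (2 * c). degree_val (2 * s) B = j} = case_prod interleave ` beta_pairs s c c j"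
proof -
  have iff: "interleave X Y \<in> beta_sets (2 * s) (2 * c) \<and> card X = c \<and> degree_val (2 * s) (interleave X Y) = j
      \<longleftrightarrow> (X, Y) \<in> beta_pairs s c c j" if "finite X" "finite Y" for X Y
    using interleave_in_beta_sets_iff[OF that, of c "int c" 0 c "2 * c" "2 * s" s j]
    by (simp add: core_size_def v2_fact_double)
  show ?thesis
  proof (intro equalityI subsetI)
    fix B assume B: "B \<in> {B \<in> beta_sets (2 * s) (2 * c). degree_val (2 * s) B = j}"
    obtain X Y where XY: "finite X" "finite Y" "B = interleave X Y"
      using B interleave_surj by (auto simp: beta_sets_iff)
    define e where "e = int (card X) - int c"
    have "e = 0 \<or> e = 1 \<or> e = -1"
      using XY B assms by (intro degree_val_large_core[of X Y "2 * c" "int c" e "2 * s"]) (auto simp: e_def)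
    moreover have "int (2 * s) = 2 * (beta_weight X + beta_weight Y) + core_size e"
      using beta_weight_interleave[OF XY(1,2), of "int c" e] XY B card_interleave[OF XY(1,2)]
      by (simp add: e_def beta_sets_iff)
    \<comment> \<open>Parity excludes the cores of size 1 and 3.\<close>
    hence "even (core_size e)" by presburger
    ultimately have "e = 0" by (auto simp: core_size_def)
    hence "card X = c" by (simp add: e_def)
    hence "(X, Y) \<in> beta_pairs s c c j" using iff[OF XY(1,2)] B XY by auto
    thus "B \<in> case_prod interleave ` beta_pairs s c c j" using XY by force
  next
    fix B assume "B \<in> case_prod interleave ` beta_pairs s c c j"
    then obtain X Y where XY: "(X, Y) \<in> beta_pairs s c c j" "B = interleave X Y" by auto
    hence "finite X" "finite Y" using beta_pairs_finite[of X Y] by auto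
    thus "B \<in> {B \<in> beta_sets (2 * s) (2 * c). degree_val (2 * s) B = j}"
      using iff[of X Y] XY by simp
  qed
qed

text \<open>Odd \<open>n\<close> leaves the cores of size 1 and 3, with runner sizes
  \<open>(c + 2, c)\<close> and \<open>(c, c + 2)\<close>. For size 3 the quotient has size
  \<open>s - 1\<close> and the core costs \<open>1 + v2 s\<close>; for \<open>s = 0\<close>, that is
  \<open>n = 1\<close>, such a core does not fit.\<close>

lemma beta_sets_odd:
  assumes "j \<le> 1"
  shows "{B \<in> beta_sets (Suc (2 * s)) (2 * Suc c). degree_val (Suc (2 * s)) B = j} =
    case_prod interleave ` (beta_pairs s (Suc (Suc c)) c j \<union>
      (if s = 0 then {} else beta_pairs (s - 1) c (Suc (Suc c)) (j - 1 - int (v2 s))))"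
    (is "?S = _ ` (?P \<union> ?Q)")
proof -
  have iff1: "interleave X Y \<in> beta_sets (Suc (2 * s)) (2 * Suc c) \<and> card X = Suc (Suc c) \<and>
      degree_val (Suc (2 * s)) (interleave X Y) = j \<longleftrightarrow> (X, Y) \<in> ?P" if "finite X" "finite Y" for X Y
  proof -
    have "int (Suc (Suc c)) = int (Suc c) + 1" "int c = int (Suc c) - 1" "int (2 * Suc c) = 2 * int (Suc c)"
      "int (Suc (2 * s)) = 2 * int s + core_size 1"
      by (simp_all add: core_size_def)
    note iff = interleave_in_beta_sets_iff[OF that this, of j]
    have "int (v2 (fact (Suc (2 * s)))) - int s - int (v2 (fact s)) = 0"
      unfolding v2_fact_Suc_double by simp
    thus ?thesis using iff by (simp only: diff_zero)
  qed
  have iff2: "interleave X Y \<in> beta_sets (Suc (2 * s)) (2 * Suc c) \<and> card X = c \<and>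
      degree_val (Suc (2 * s)) (interleave X Y) = j \<longleftrightarrow> (X, Y) \<in> ?Q"
    if "finite X" "finite Y" "0 < s" for X Y
  proof -
    have "int c = int (Suc c) + (-1)" "int (Suc (Suc c)) = int (Suc c) - (-1)"
      "int (2 * Suc c) = 2 * int (Suc c)" "int (Suc (2 * s)) = 2 * int (s - 1) + core_size (-1)"
      using that(3) by (simp_all add: core_size_def of_nat_diff)
    note iff = interleave_in_beta_sets_iff[OF that(1,2) this, of j]
    have "v2 (fact s) = v2 s + v2 (fact (s - 1))"
      using that(3) v2_mult[of s "fact (s - 1)"] by (simp add: fact_reduce)
    hence "j - (int (v2 (fact (Suc (2 * s)))) - int (s - 1) - int (v2 (fact (s - 1)))) = j - 1 - int (v2 s)"
      unfolding v2_fact_Suc_double using that(3) by (simp add: of_nat_diff)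
    thus ?thesis using iff that(3) by (simp only: if_False less_not_refl2[OF that(3)] simp_thms)
  qed
  show ?thesis
  proof (intro equalityI subsetI)
    fix B assume B: "B \<in> ?S"
    obtain X Y where XY: "finite X" "finite Y" "B = interleave X Y"
      using B interleave_surj by (auto simp: beta_sets_iff)
    define e where "e = int (card X) - int (Suc c)"
    have "e = 0 \<or> e = 1 \<or> e = -1"
      using XY B assms
      by (intro degree_val_large_core[of X Y "2 * Suc c" "int (Suc c)" e "Suc (2 * s)"]) (auto simp: e_def)
    moreover have n: "int (Suc (2 * s)) = 2 * (beta_weight X + beta_weight Y) + core_size e"
      using beta_weight_interleave[OF XY(1,2), of "int (Suc c)" e] XY B card_interleave[OF XY(1,2)]
      by (simp add: e_def beta_sets_iff)
    hence "odd (core_size e)" by presburger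
    ultimately consider "e = 1" | "e = -1" by (auto simp: core_size_def)
    thus "B \<in> case_prod interleave ` (?P \<union> ?Q)"
    proof cases
      case 1
      hence "(X, Y) \<in> ?P" using iff1[OF XY(1,2)] B XY by (auto simp: e_def)
      thus ?thesis using XY by force
    next
      case 2
      hence "0 < s" using n beta_weight_nonneg[OF XY(1)] beta_weight_nonneg[OF XY(2)]
        by (simp add: core_size_def)
      hence "(X, Y) \<in> ?Q" using iff2[OF XY(1,2)] B XY 2 by (auto simp: e_def)
      thus ?thesis using XY by force
    qed
  next
    fix B assume "B \<in> case_prod interleave ` (?P \<union> ?Q)"
    then obtain X Y where XY: "(X, Y) \<in> ?P \<union> ?Q" "B = interleave X Y" by auto
    have fin: "finite X" "finite Y"
      using XY(1) by (auto dest: beta_pairs_finite split: if_splits)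
    show "B \<in> ?S"
    proof (cases "(X, Y) \<in> ?P")
      case True
      thus ?thesis using iff1[OF fin] XY by auto
    next
      case False
      hence "(X, Y) \<in> ?Q" using XY by blast
      moreover have "0 < s" using calculation by (auto split: if_splits)
      ultimately show ?thesis using iff2[OF fin] XY by auto
    qed
  qed
qed

section \<open>Counting pairs by convolutions\<close>

lemma beta_pairs_UN:
  "beta_pairs s p q j = (\<Union>u\<le>s. {(X, Y) \<in> beta_sets u p \<times> beta_sets (s - u) q.
     int (v2 (s choose u)) + degree_val u X + degree_val (s - u) Y = j})"
  by (auto simp: beta_pairs_def)

lemma finite_beta_pairs [simp]: "finite (beta_pairs s p q j)"
  unfolding beta_pairs_UN
  by (intro finite_UN_I finite_atMost) (rule finite_subset[OF _ finite_cartesian_product[OF finite_beta_sets finite_beta_sets]], auto)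

text \<open>The union is disjoint because \<open>u\<close> is the weight of
  \<open>X\<close>.\<close>

lemma card_beta_pairs:
  "card (beta_pairs s p q j) = (\<Sum>u\<le>s. card {(X, Y) \<in> beta_sets u p \<times> beta_sets (s - u) q.
     int (v2 (s choose u)) + degree_val u X + degree_val (s - u) Y = j})"
  unfolding beta_pairs_UN
proof (rule card_UN_disjoint)
  show "\<forall>u\<in>{..s}. finite {(X, Y) \<in> beta_sets u p \<times> beta_sets (s - u) q.
     int (v2 (s choose u)) + degree_val u X + degree_val (s - u) Y = j}"
    by (intro ballI, rule finite_subset[OF _ finite_cartesian_product[OF finite_beta_sets finite_beta_sets]], auto)
qed (auto simp: beta_sets_iff)

lemma beta_pairs_neg:
  assumes "j < 0"
  shows "beta_pairs s p q j = {}"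
proof -
  have "0 \<le> j" if XY: "(X, Y) \<in> beta_pairs s p q j" for X Y
  proof -
    obtain u where u: "X \<in> beta_sets u p" "Y \<in> beta_sets (s - u) q"
      "int (v2 (s choose u)) + degree_val u X + degree_val (s - u) Y = j"
      using XY by (auto simp: beta_pairs_def)
    thus ?thesis using degree_val_nonneg[OF u(1)] degree_val_nonneg[OF u(2)] by linarith
  qed
  thus ?thesis using assms by fastforce
qed

text \<open>By Kummer's theorem \<open>j\<close> is the number of carries in the binary addition of
  \<open>u\<close> and \<open>s - u\<close>.\<close>

definition conv :: "(nat \<Rightarrow> nat) \<Rightarrow> (nat \<Rightarrow> nat) \<Rightarrow> nat \<Rightarrow> nat \<Rightarrow> nat" where
  "conv f g j s = (\<Sum>u | u \<le> s \<and> v2 (s choose u) = j. f u * g (s - u))"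

text \<open>The three summands are nonnegative: a total of 0 makes all of them vanish, a total of 1
  puts a 1 in exactly one place.\<close>

lemma card_degree_pairs:
  assumes "u \<le> p" "w \<le> q"
  shows "card {(X, Y) \<in> beta_sets u p \<times> beta_sets w q. int v + degree_val u X + degree_val w Y = 0} =
      (if v = 0 then a_odd u * a_odd w else 0)" (is "?zero")
    and "card {(X, Y) \<in> beta_sets u p \<times> beta_sets w q. int v + degree_val u X + degree_val w Y = 1} =
      (if v = 0 then a_odd u * a_mod4 2 w + a_mod4 2 u * a_odd w
       else if v = 1 then a_odd u * a_odd w else 0)" (is ?one)
proof -
  define D where "D = (\<lambda>n k j. {B \<in> beta_sets n k. degree_val n B = j})"
  have card: "a_odd u = card (D u p 0)" "a_odd w = card (D w q 0)"
    "a_mod4 2 u = card (D u p 1)" "a_mod4 2 w = card (D w q 1)"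
    using assms by (simp_all add: D_def a_odd_beta_sets a_mod4_2_beta_sets)
  have fin: "finite (D n k j)" for n k j by (simp add: D_def)
  have pos: "0 \<le> degree_val u X" "0 \<le> degree_val w Y"
    if "X \<in> beta_sets u p" "Y \<in> beta_sets w q" for X Y
    using that degree_val_nonneg by blast+
  have "{(X, Y) \<in> beta_sets u p \<times> beta_sets w q. int v + degree_val u X + degree_val w Y = 0} =
      (if v = 0 then D u p 0 \<times> D w q 0 else {})" (is "?A = ?B")
  proof (intro set_eqI)
    fix XY :: "nat set \<times> nat set"
    obtain X Y where XY: "XY = (X, Y)" by (cases XY)
    show "XY \<in> ?A \<longleftrightarrow> XY \<in> ?B"
    proof (cases "X \<in> beta_sets u p \<and> Y \<in> beta_sets w q")
      case True
      hence "0 \<le> degree_val u X" "0 \<le> degree_val w Y" using pos by auto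
      thus ?thesis unfolding XY using True by (simp add: D_def) linarith
    qed (auto simp: XY D_def)
  qed
  thus ?zero by (simp add: card card_cartesian_product)
  have split: "{(X, Y) \<in> beta_sets u p \<times> beta_sets w q. int v + degree_val u X + degree_val w Y = 1} =
      (if v = 0 then D u p 0 \<times> D w q 1 \<union> D u p 1 \<times> D w q 0
       else if v = 1 then D u p 0 \<times> D w q 0 else {})" (is "?A = ?B")
  proof (intro set_eqI)
    fix XY :: "nat set \<times> nat set"
    obtain X Y where XY: "XY = (X, Y)" by (cases XY)
    show "XY \<in> ?A \<longleftrightarrow> XY \<in> ?B"
    proof (cases "X \<in> beta_sets u p \<and> Y \<in> beta_sets w q")
      case True
      hence "0 \<le> degree_val u X" "0 \<le> degree_val w Y" using pos by auto
      thus ?thesis unfolding XY using True by (simp add: D_def) linarith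
    qed (auto simp: XY D_def)
  qed
  have "card (D u p 0 \<times> D w q 1 \<union> D u p 1 \<times> D w q 0) =
      card (D u p 0 \<times> D w q 1) + card (D u p 1 \<times> D w q 0)"
    using fin by (intro card_Un_disjoint) (auto simp: D_def)
  thus ?one unfolding split by (simp add: card card_cartesian_product)
qed

lemma card_beta_pairs_0:
  assumes "s \<le> p" "s \<le> q"
  shows "card (beta_pairs s p q 0) = conv a_odd a_odd 0 s"
proof -
  have "card (beta_pairs s p q 0) = (\<Sum>u\<le>s. if v2 (s choose u) = 0 then a_odd u * a_odd (s - u) else 0)"
    unfolding card_beta_pairs using assms by (intro sum.cong refl card_degree_pairs) auto
  thus ?thesis by (simp add: conv_def sum.If_cases Int_def conj_commute)
qed

lemma card_beta_pairs_1:
  assumes "s \<le> p" "s \<le> q"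
  shows "card (beta_pairs s p q 1) =
    conv a_odd (a_mod4 2) 0 s + conv (a_mod4 2) a_odd 0 s + conv a_odd a_odd 1 s"
proof -
  have "card (beta_pairs s p q 1) = (\<Sum>u\<le>s. if v2 (s choose u) = 0
      then a_odd u * a_mod4 2 (s - u) + a_mod4 2 u * a_odd (s - u)
      else if v2 (s choose u) = 1 then a_odd u * a_odd (s - u) else 0)"
    unfolding card_beta_pairs using assms by (intro sum.cong refl card_degree_pairs) auto
  also have "\<dots> = (\<Sum>u\<le>s. (if v2 (s choose u) = 0 then a_odd u * a_mod4 2 (s - u) else 0)
      + (if v2 (s choose u) = 0 then a_mod4 2 u * a_odd (s - u) else 0)
      + (if v2 (s choose u) = 1 then a_odd u * a_odd (s - u) else 0))"
    by (intro sum.cong) auto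
  finally show ?thesis by (simp add: sum.distrib conv_def sum.If_cases Int_def conj_commute)
qed

text \<open>Both parities give the same convolution, because the cores of size 0 and 1 add no
  valuation while the core of size 3 adds at least 1.\<close>

lemma a_odd_recurrence: "a_odd n = conv a_odd a_odd 0 (n div 2)"
proof (cases "even n")
  case True
  then obtain s where s: "n = 2 * s" by blast
  have "a_odd n = card (case_prod interleave ` beta_pairs s s s 0)"
    unfolding s using beta_sets_even[of 0 s s] a_odd_beta_sets[of "2 * s" "2 * s"] by simp
  thus ?thesis unfolding s by (simp add: card_image[OF inj_on_interleave] card_beta_pairs_0)
next
  case False
  then obtain s where s: "n = Suc (2 * s)" by (auto elim: oddE)
  have "a_odd n = card (case_prod interleave ` beta_pairs s (Suc (Suc s)) s 0)"
    unfolding s using beta_sets_odd[of 0 s s] a_odd_beta_sets[of "Suc (2 * s)" "2 * Suc s"]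
    by (simp add: beta_pairs_neg)
  thus ?thesis unfolding s by (simp add: card_image[OF inj_on_interleave] card_beta_pairs_0)
qed

text \<open>The last term comes from the core of size 3. For \<open>n = 2 * s + 1\<close> it adds
  \<open>1 + v2 s\<close>, which is 1 only for odd \<open>s\<close>, and then everything else must
  have valuation 0.\<close>

lemma a_mod4_2_recurrence:
  "a_mod4 2 n = conv a_odd (a_mod4 2) 0 (n div 2) + conv (a_mod4 2) a_odd 0 (n div 2)
     + conv a_odd a_odd 1 (n div 2) + (if n mod 4 = 3 then conv a_odd a_odd 0 ((n - 3) div 2) else 0)"
proof (cases "even n")
  case True
  then obtain s where s: "n = 2 * s" by blast
  have "a_mod4 2 n = card (case_prod interleave ` beta_pairs s s s 1)"
    unfolding s using beta_sets_even[of 1 s s] a_mod4_2_beta_sets[of "2 * s" "2 * s"] by simp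
  moreover have "n mod 4 \<noteq> 3" using True by presburger
  ultimately show ?thesis unfolding s by (simp add: card_image[OF inj_on_interleave] card_beta_pairs_1)
next
  case False
  then obtain s where s: "n = Suc (2 * s)" by (auto elim: oddE)
  let ?Q = "if s = 0 then {} else beta_pairs (s - 1) s (Suc (Suc s)) (- int (v2 s))"
  have "a_mod4 2 n = card (case_prod interleave ` (beta_pairs s (Suc (Suc s)) s 1 \<union> ?Q))"
    unfolding s using beta_sets_odd[of 1 s s] a_mod4_2_beta_sets[of "Suc (2 * s)" "2 * Suc s"] by simp
  also have "\<dots> = card (beta_pairs s (Suc (Suc s)) s 1 \<union> ?Q)"
    by (rule card_image[OF inj_on_interleave])
  also have "\<dots> = card (beta_pairs s (Suc (Suc s)) s 1) + card ?Q"
  proof (rule card_Un_disjoint)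
    \<comment> \<open>The first components have different cardinalities, \<open>s + 2\<close> and
      \<open>s\<close>.\<close>
    show "beta_pairs s (Suc (Suc s)) s 1 \<inter> ?Q = {}"
      by (auto dest!: beta_pairs_finite split: if_splits)
  qed auto
  also have "card ?Q = (if n mod 4 = 3 then conv a_odd a_odd 0 ((n - 3) div 2) else 0)"
  proof (cases "odd s")
    case True
    hence "n mod 4 = 3" "(n - 3) div 2 = s - 1" "0 < s" "v2 s = 0"
      unfolding s by (presburger, (auto simp: v2_odd intro: gr0I)+)
    thus ?thesis by (simp add: card_beta_pairs_0)
  next
    case False
    hence "n mod 4 \<noteq> 3" unfolding s by presburger
    moreover have "?Q = {}"
    proof (cases "s = 0")
      case False
      hence "v2 s \<noteq> 0" using \<open>\<not> odd s\<close> v2_eq_0_iff[of s] by auto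
      thus ?thesis by (simp add: beta_pairs_neg)
    qed simp
    ultimately show ?thesis by (simp only: card.empty if_False)
  qed
  finally show ?thesis unfolding s by (simp add: card_beta_pairs_1)
qed

subsection \<open>Carries at the top bit\<close>

text \<open>By Legendre's formula this is the number of ones in the binary expansion of \<open>n\<close>.\<close>

definition bit_count :: "nat \<Rightarrow> int" where
  "bit_count n = int n - int (v2 (fact n))"

text \<open>Kummer's theorem: each carry lowers the total number of ones by 1.\<close>

lemma v2_binomial: "u \<le> s \<Longrightarrow> int (v2 (s choose u)) = bit_count u + bit_count (s - u) - bit_count s"
  using v2_fact_add[of u "s - u"] by (simp add: bit_count_def)

text \<open>Halving moves the top bit down one place and discards the same lowest bit on both
  sides.\<close>

lemma bit_count_top: "m < 2 ^ R \<Longrightarrow> bit_count (2 ^ R + m) = bit_count m + 1"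
proof (induction R arbitrary: m)
  case 0
  thus ?case by (simp add: bit_count_def)
next
  case (Suc R)
  have half: "(2 ^ Suc R + m) div 2 = 2 ^ R + m div 2" by simp
  have "bit_count (2 ^ R + m div 2) = bit_count (m div 2) + 1"
    using Suc by (intro Suc.IH) (simp add: less_mult_imp_div_less)
  moreover have "v2 (fact (2 ^ Suc R + m)) = 2 ^ R + m div 2 + v2 (fact (2 ^ R + m div 2))"
    using v2_fact[of "2 ^ Suc R + m"] unfolding half .
  ultimately show ?case
    using v2_fact[of m] by (simp add: bit_count_def)
qed

text \<open>The bit \<open>2 ^ R\<close> of the sum is present in neither summand, so a carry enters
  it. The cases record which summands contain the next lower bit \<open>H\<close>.\<close>

lemma binomial_carry:
  assumes "u < 2 ^ R" "w < 2 ^ R" "2 ^ R \<le> u + w"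
  shows "0 < v2 ((u + w) choose u)"
proof (cases R)
  case 0
  thus ?thesis using assms by simp
next
  case (Suc r)
  define H :: nat where "H = 2 ^ r"
  obtain m where m: "u + w = 2 ^ R + m" using assms(3) le_Suc_ex by blast
  have R: "2 ^ R = 2 * H" by (simp add: Suc H_def)
  have mR: "m < 2 ^ R" using assms m by linarith
  have v: "int (v2 ((u + w) choose u)) = bit_count u + bit_count w - bit_count m - 1"
    using v2_binomial[of u "u + w"] bit_count_top[OF mR, folded m] by simp
  have half: "bit_count (H + x) = bit_count x + 1" if "x < H" for x
    using bit_count_top[of x r] that by (simp add: H_def)
  have nonneg: "0 \<le> bit_count x + bit_count y - bit_count (x + y)" for x y
    using v2_binomial[of x "x + y"] by simp
  \<comment> \<open>With \<open>H\<close> in only one summand, the lower parts add up to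
    \<open>H + m\<close>, which has one more bit than \<open>m\<close>.\<close>
  have mixed: "1 \<le> bit_count (H + x) + bit_count y - bit_count m - 1"
    if "x < H" "y < H" "x + y = H + m" for x y
    using half[OF that(1)] half[of m] nonneg[of x y] that by simp
  show ?thesis
  proof (cases "H \<le> u")
    case True
    then obtain a where a: "u = H + a" using le_Suc_ex by blast
    show ?thesis
    proof (cases "H \<le> w")
      case True
      then obtain b where b: "w = H + b" using le_Suc_ex by blast
      have "a < H" "b < H" "a + b = m" using a b assms m R by linarith+
      thus ?thesis using v half[of a] half[of b] nonneg[of a b] a b by simp
    next
      case False
      hence "1 \<le> bit_count (H + a) + bit_count w - bit_count m - 1"
        using a assms m R by (intro mixed) linarith+
      thus ?thesis using v a by simp
    qed
  next
    case False
    hence "H \<le> w" using assms R by linarith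
    then obtain b where b: "w = H + b" using le_Suc_ex by blast
    have "1 \<le> bit_count (H + b) + bit_count u - bit_count m - 1"
      using False b assms m R by (intro mixed) linarith+
    thus ?thesis using v b by simp
  qed
qed

text \<open>A carry must leave bit \<open>R\<close>. If both summands contain that bit, it is the
  only carry exactly when the lower parts add without carry. If only one does, a further carry has
  to enter bit \<open>R\<close>, so there are at least two.\<close>

lemma binomial_single_carry:
  assumes "u < 2 ^ Suc R" "w < 2 ^ Suc R" "u + w = 2 ^ Suc R + m"
  shows "v2 ((u + w) choose u) = 1 \<longleftrightarrow>
    m < 2 ^ R \<and> 2 ^ R \<le> u \<and> u \<le> 2 ^ R + m \<and> v2 (m choose (u - 2 ^ R)) = 0"
proof -
  define H :: nat where "H = 2 ^ R"
  have R: "2 ^ Suc R = 2 * H" by (simp add: H_def)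
  have mR: "m < 2 ^ Suc R" using assms by linarith
  have v: "int (v2 ((u + w) choose u)) = bit_count u + bit_count w - bit_count m - 1"
    using v2_binomial[of u "u + w"] bit_count_top[OF mR, folded assms(3)] by simp
  have half: "bit_count (H + x) = bit_count x + 1" if "x < H" for x
    using bit_count_top[of x R] that by (simp add: H_def)
  have mixed: "1 < bit_count (H + x) + bit_count y - bit_count m - 1"
    if "x < H" "y < H" "x + y = H + m" for x y
  proof -
    have "0 < v2 ((x + y) choose x)" using that by (intro binomial_carry[of _ R]) (auto simp: H_def)
    moreover have "m < H" using that by linarith
    ultimately show ?thesis
      using half[OF that(1)] half[of m, folded that(3)] v2_binomial[of x "x + y"] by simp
  qed
  show ?thesis
  proof (cases "H \<le> u \<and> H \<le> w")
    case True
    then obtain a b where ab: "u = H + a" "w = H + b" by (metis le_Suc_ex)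
    have lt: "a < H" "b < H" "a + b = m" using ab assms R by linarith+
    hence "int (v2 ((u + w) choose u)) = 1 + int (v2 (m choose a))"
      using v half[of a] half[of b] v2_binomial[of a m] ab by auto
    \<comment> \<open>A carry-free sum of two numbers below \<open>H\<close> stays below
      \<open>H\<close>.\<close>
    moreover have "m < H" if "v2 (m choose a) = 0"
      using binomial_carry[of a R b] that lt by (force simp: H_def)
    ultimately show ?thesis using ab lt by (auto simp: H_def[symmetric])
  next
    case False
    have "1 < int (v2 ((u + w) choose u))"
    proof (cases "H \<le> u")
      case True
      then obtain a where a: "u = H + a" using le_Suc_ex by blast
      have "1 < bit_count (H + a) + bit_count w - bit_count m - 1"
        using True False a assms R by (intro mixed) linarith+
      thus ?thesis using v a by simp
    next
      case False
      hence "H \<le> w" using assms R by linarith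
      then obtain b where b: "w = H + b" using le_Suc_ex by blast
      have "1 < bit_count (H + b) + bit_count u - bit_count m - 1"
        using False b assms R by (intro mixed) linarith+
      thus ?thesis using v b by simp
    qed
    \<comment> \<open>Since \<open>w = 2 * H + m - u\<close>, the bound \<open>u \<le> H + m\<close>
      says that \<open>H \<le> w\<close>.\<close>
    moreover have "\<not> (H \<le> u \<and> u \<le> H + m)" using False assms R by linarith
    ultimately show ?thesis by (auto simp: H_def[symmetric])
  qed
qed

section \<open>Splitting convolutions at the top bit\<close>

definition carry_set :: "nat \<Rightarrow> nat \<Rightarrow> nat set" where
  "carry_set j s = {u. u \<le> s \<and> v2 (s choose u) = j}"

lemma finite_carry_set [simp]: "finite (carry_set j s)"
  by (rule finite_subset[of _ "{..s}"]) (auto simp: carry_set_def)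

lemma v2_binomial_top_right:
  assumes "m < 2 ^ R" "u \<le> m"
  shows "v2 ((2 ^ R + m) choose u) = v2 (m choose u)"
proof -
  have "bit_count (2 ^ R + m - u) = bit_count (m - u) + 1"
    using bit_count_top[of "m - u" R] assms by simp
  thus ?thesis
    using v2_binomial[of u "2 ^ R + m"] v2_binomial[of u m] bit_count_top[OF assms(1)] assms by simp
qed

lemma v2_binomial_top_left:
  assumes "m < 2 ^ R" "u \<le> m"
  shows "v2 ((2 ^ R + m) choose (2 ^ R + u)) = v2 (m choose u)"
  using v2_binomial[of "2 ^ R + u" "2 ^ R + m"] v2_binomial[of u m] bit_count_top[OF assms(1)]
    bit_count_top[of u R] assms by simp

text \<open>The top bit of the sum lies in the second summand, in the first, or in neither; in the
  last case a carry produces it.\<close>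

lemma carry_set_top:
  assumes "m < 2 ^ R"
  shows "carry_set j (2 ^ R + m) = carry_set j m \<union> (+) (2 ^ R) ` carry_set j m \<union>
    {u. m < u \<and> u < 2 ^ R \<and> v2 ((2 ^ R + m) choose u) = j}" (is "?A = ?B")
proof (intro set_eqI)
  fix u
  consider "u \<le> m" | "m < u" "u < 2 ^ R" | a where "u = 2 ^ R + a"
    by (metis le_Suc_ex linorder_not_le)
  thus "u \<in> ?A \<longleftrightarrow> u \<in> ?B"
  proof cases
    case 1
    thus ?thesis using assms v2_binomial_top_right[OF assms 1] by (auto simp: carry_set_def)
  next
    case 2
    thus ?thesis using assms by (auto simp: carry_set_def)
  next
    case 3
    thus ?thesis using assms v2_binomial_top_left[OF assms, of a] by (auto simp: carry_set_def)
  qed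
qed

text \<open>Real values, because the closed form involves a division.\<close>

definition rconv :: "nat \<Rightarrow> (nat \<Rightarrow> real) \<Rightarrow> (nat \<Rightarrow> real) \<Rightarrow> nat \<Rightarrow> real" where
  "rconv j f g s = (\<Sum>u\<in>carry_set j s. f u * g (s - u))"

lemma conv_eq_rconv: "real (conv f g j s) = rconv j (\<lambda>n. real (f n)) (\<lambda>n. real (g n)) s"
  by (simp add: conv_def rconv_def carry_set_def)

lemma rconv_cong:
  assumes "\<And>u. u \<le> s \<Longrightarrow> f u = f' u" "\<And>u. u \<le> s \<Longrightarrow> g u = g' u"
  shows "rconv j f g s = rconv j f' g' s"
  unfolding rconv_def using assms by (intro sum.cong) (auto simp: carry_set_def)

lemma rconv_commute: "rconv j f g s = rconv j g f s"
  unfolding rconv_def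
  by (rule sum.reindex_bij_witness[of _ "\<lambda>u. s - u" "\<lambda>u. s - u"])
    (auto simp: carry_set_def binomial_symmetric[symmetric])

lemma rconv_scale: "rconv j (\<lambda>u. c * f u) g s = c * rconv j f g s" "rconv j f (\<lambda>u. c * g u) s = c * rconv j f g s"
  by (simp_all add: rconv_def sum_distrib_left algebra_simps)

lemma rconv_add: "rconv j (\<lambda>u. f u + f' u) g s = rconv j f g s + rconv j f' g s"
  by (simp add: rconv_def sum.distrib algebra_simps)

lemma rconv_top_general:
  assumes "m < 2 ^ R"
  shows "rconv j f g (2 ^ R + m) =
    rconv j f (\<lambda>w. g (2 ^ R + w)) m + rconv j (\<lambda>u. f (2 ^ R + u)) g m +
    (\<Sum>u | m < u \<and> u < 2 ^ R \<and> v2 ((2 ^ R + m) choose u) = j. f u * g (2 ^ R + m - u))"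
proof -
  let ?M = "{u. m < u \<and> u < 2 ^ R \<and> v2 ((2 ^ R + m) choose u) = j}"
  let ?h = "\<lambda>u. f u * g (2 ^ R + m - u)"
  have le: "u \<le> m" if "u \<in> carry_set j m" for u using that by (simp add: carry_set_def)
  have "rconv j f g (2 ^ R + m) =
      sum ?h (carry_set j m \<union> (+) (2 ^ R) ` carry_set j m) + sum ?h ?M"
    unfolding rconv_def carry_set_top[OF assms] using assms
    by (intro sum.union_disjoint) (auto simp: carry_set_def)
  also have "sum ?h (carry_set j m \<union> (+) (2 ^ R) ` carry_set j m) =
      sum ?h (carry_set j m) + sum ?h ((+) (2 ^ R) ` carry_set j m)"
    using assms by (intro sum.union_disjoint) (auto simp: carry_set_def)
  also have "sum ?h (carry_set j m) = rconv j f (\<lambda>w. g (2 ^ R + w)) m"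
    unfolding rconv_def by (intro sum.cong) (auto dest: le)
  also have "sum ?h ((+) (2 ^ R) ` carry_set j m) = rconv j (\<lambda>u. f (2 ^ R + u)) g m"
    unfolding rconv_def by (subst sum.reindex) auto
  finally show ?thesis .
qed

text \<open>Without carries the top bit must come from one of the summands.\<close>

lemma rconv_0_top:
  assumes "m < 2 ^ R"
  shows "rconv 0 f g (2 ^ R + m) =
    rconv 0 f (\<lambda>w. g (2 ^ R + w)) m + rconv 0 (\<lambda>u. f (2 ^ R + u)) g m"
proof -
  have empty: "{u. m < u \<and> u < 2 ^ R \<and> v2 ((2 ^ R + m) choose u) = 0} = {}"
  proof -
    have "0 < v2 ((2 ^ R + m) choose u)" if "m < u" "u < 2 ^ R" for u
      using binomial_carry[of u R "2 ^ R + m - u"] that by simp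
    thus ?thesis by auto
  qed
  show ?thesis unfolding rconv_top_general[OF assms, of 0 f g] empty by simp
qed

text \<open>In the additional term the top bit is generated by the single carry out of two bits
  \<open>2 ^ R\<close>.\<close>

lemma rconv_1_top:
  assumes "m < 2 ^ Suc R"
  shows "rconv 1 f g (2 ^ Suc R + m) =
    rconv 1 f (\<lambda>w. g (2 ^ Suc R + w)) m + rconv 1 (\<lambda>u. f (2 ^ Suc R + u)) g m +
    (if m < 2 ^ R then rconv 0 (\<lambda>u. f (2 ^ R + u)) (\<lambda>w. g (2 ^ R + w)) m else 0)"
proof -
  let ?M = "{u. m < u \<and> u < 2 ^ Suc R \<and> v2 ((2 ^ Suc R + m) choose u) = 1}"
  let ?h = "\<lambda>u. f u * g (2 ^ Suc R + m - u)"
  have iff: "v2 ((2 ^ Suc R + m) choose u) = 1 \<longleftrightarrow>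
      m < 2 ^ R \<and> 2 ^ R \<le> u \<and> u \<le> 2 ^ R + m \<and> v2 (m choose (u - 2 ^ R)) = 0"
    if "m < u" "u < 2 ^ Suc R" for u
    using binomial_single_carry[of u R "2 ^ Suc R + m - u" m] that by simp
  have "sum ?h ?M = (if m < 2 ^ R then rconv 0 (\<lambda>u. f (2 ^ R + u)) (\<lambda>w. g (2 ^ R + w)) m else 0)"
  proof (cases "m < 2 ^ R")
    case True
    have M: "?M = (+) (2 ^ R) ` carry_set 0 m"
    proof (intro equalityI subsetI)
      fix u assume u: "u \<in> ?M"
      hence "2 ^ R \<le> u" "u - 2 ^ R \<in> carry_set 0 m" using iff[of u] by (auto simp: carry_set_def)
      thus "u \<in> (+) (2 ^ R) ` carry_set 0 m" by (intro image_eqI[of _ _ "u - 2 ^ R"]) auto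
    next
      fix u assume "u \<in> (+) (2 ^ R) ` carry_set 0 m"
      then obtain a where a: "u = 2 ^ R + a" "a \<le> m" "v2 (m choose a) = 0" by (auto simp: carry_set_def)
      hence "m < u" "u < 2 ^ Suc R" using True by auto
      thus "u \<in> ?M" using iff[of u] a True by simp
    qed
    have "sum ?h ?M = (\<Sum>a\<in>carry_set 0 m. ?h (2 ^ R + a))"
      unfolding M by (simp add: sum.reindex)
    also have "\<dots> = rconv 0 (\<lambda>u. f (2 ^ R + u)) (\<lambda>w. g (2 ^ R + w)) m"
      unfolding rconv_def by (intro sum.cong) (auto simp: carry_set_def)
    finally show ?thesis using True by simp
  next
    case False
    have "?M = {}" using iff False by blast
    thus ?thesis using False by (simp only: sum.empty if_False)
  qed
  thus ?thesis unfolding rconv_top_general[OF assms, of 1 f g] by (simp only:)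
qed

section \<open>Closed forms by induction on the top bit\<close>

definition odd_count :: "nat \<Rightarrow> real" where
  "odd_count n = real (a_odd n)"

definition two_count :: "nat \<Rightarrow> real" where
  "two_count n = real (a_mod4 2 n)"

lemma odd_count_rec: "odd_count n = rconv 0 odd_count odd_count (n div 2)"
  unfolding odd_count_def by (subst a_odd_recurrence) (simp add: conv_eq_rconv)

lemma two_count_rec:
  "two_count n = 2 * rconv 0 two_count odd_count (n div 2) + rconv 1 odd_count odd_count (n div 2)
     + (if n mod 4 = 3 then rconv 0 odd_count odd_count ((n - 3) div 2) else 0)"
  unfolding two_count_def odd_count_def
  by (subst a_mod4_2_recurrence)
    (simp add: conv_eq_rconv rconv_commute[of 0 "\<lambda>n. real (a_odd n)" "\<lambda>n. real (a_mod4 2 n)"])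

lemma rconv_zero [simp]: "rconv 0 f g 0 = f 0 * g 0" "rconv (Suc j) f g 0 = 0"
proof -
  have "carry_set 0 0 = {0}" "carry_set (Suc j) 0 = {}" by (auto simp: carry_set_def)
  thus "rconv 0 f g 0 = f 0 * g 0" "rconv (Suc j) f g 0 = 0" by (simp_all add: rconv_def)
qed

lemma rconv_one:
  "rconv 0 f g 1 = f 0 * g 1 + f 1 * g 0" "rconv 1 f g 1 = 0"
proof -
  have v: "v2 (Suc 0 choose u) = 0" if "u \<le> Suc 0" for u
    using that by (cases u) auto
  have "carry_set 0 1 = {0, 1}" "carry_set 1 1 = {}" using v by (auto simp: carry_set_def)
  thus "rconv 0 f g 1 = f 0 * g 1 + f 1 * g 0" "rconv 1 f g 1 = 0" by (simp_all add: rconv_def)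
qed

lemma odd_count_0: "odd_count 0 = 1"
proof -
  have "lam \<in> partitions 0 \<longleftrightarrow> lam = []" for lam
    using length_le_sum_list[of lam] by (cases lam) (auto simp: partitions_def)
  moreover have "f_syt [] = 1" by (rule f_syt_empty) simp
  ultimately have "{lam \<in> partitions 0. f_syt lam mod 4 = 1} = {[]}"
    "{lam \<in> partitions 0. f_syt lam mod 4 = 3} = {}"
    by (simp_all add: Collect_conv_if)
  hence "a_mod4 1 0 = 1" "a_mod4 3 0 = 0" unfolding a_mod4_def by (simp_all only:) simp_all
  thus ?thesis by (simp add: odd_count_def a_odd_def)
qed

lemma odd_count_1: "odd_count 1 = 1"
  using odd_count_rec[of 1] by (simp add: odd_count_0)

lemma two_count_small: "two_count 0 = 0" "two_count 1 = 0"
proof -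
  show "two_count 0 = 0" using two_count_rec[of 0] by (simp add: odd_count_0)
  thus "two_count 1 = 0" using two_count_rec[of 1] by (simp add: odd_count_0)
qed

text \<open>The top bit of the half can go to either summand, and each choice contributes a factor
  \<open>2 ^ R\<close>.\<close>

lemma odd_count_top: "m < 2 ^ R \<Longrightarrow> odd_count (2 ^ R + m) = 2 ^ R * odd_count m"
proof (induction R arbitrary: m)
  case 0
  thus ?case using odd_count_1 by (simp add: odd_count_0)
next
  case (Suc R)
  have m: "m div 2 < 2 ^ R" using Suc.prems by (simp add: less_mult_imp_div_less)
  have IH: "odd_count (2 ^ R + u) = 2 ^ R * odd_count u" if "u \<le> m div 2" for u
    using Suc.IH that m by simp
  have half: "(2 ^ Suc R + m) div 2 = 2 ^ R + m div 2" by simp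
  have "odd_count (2 ^ Suc R + m) = rconv 0 odd_count odd_count (2 ^ R + m div 2)"
    using odd_count_rec[of "2 ^ Suc R + m"] unfolding half .
  also have "\<dots> = rconv 0 odd_count (\<lambda>w. 2 ^ R * odd_count w) (m div 2) +
      rconv 0 (\<lambda>u. 2 ^ R * odd_count u) odd_count (m div 2)"
    using IH unfolding rconv_0_top[OF m] by (intro arg_cong2[where f = "(+)"] rconv_cong) auto
  also have "\<dots> = 2 ^ Suc R * odd_count m"
    by (simp add: rconv_scale odd_count_rec[of m])
  finally show ?case .
qed

definition low_excess :: "nat \<Rightarrow> real" where
  "low_excess H = real (H choose 2)"

definition high_excess :: "nat \<Rightarrow> real" where
  "high_excess H = (real (H choose 3) + real H) / real H"

lemma real_choose_2: "real (n choose 2) = real n * (real n - 1) / 2"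
  by (induction n) (simp_all add: choose_reduce_nat[of "Suc _" 2] numeral_2_eq_2 field_simps)

lemma real_choose_3: "real (n choose 3) = real n * (real n - 1) * (real n - 2) / 6"
proof (induction n)
  case (Suc n)
  have "Suc n choose 3 = (n choose 2) + (n choose 3)"
    using binomial_Suc_Suc[of n 2] by (simp add: numeral_3_eq_3 numeral_2_eq_2)
  thus ?case by (simp add: Suc real_choose_2 field_simps)
qed simp

text \<open>The recurrence below the half: two placements of the top bit, plus the square from the
  single carry.\<close>

lemma low_excess_double: "2 * low_excess H + real H ^ 2 = low_excess (2 * H)"
  by (simp add: low_excess_def real_choose_2 field_simps power2_eq_square)

lemma high_excess_double: "0 < H \<Longrightarrow> low_excess H + high_excess H = high_excess (2 * H)"
  by (simp add: low_excess_def high_excess_def real_choose_2 real_choose_3 field_simps)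

definition excess :: "nat \<Rightarrow> nat \<Rightarrow> real" where
  "excess H m = (if m < H then low_excess H else high_excess H) * odd_count m"

text \<open>If \<open>m\<close> contains the bit \<open>2 ^ R\<close>, that bit goes to the argument
  of the excess, giving \<open>high_excess\<close>, or to the other argument, leaving
  \<open>low_excess\<close>. By \<open>odd_count_top\<close> both placements have the same
  weight.\<close>

lemma rconv_excess:
  assumes "m < 2 ^ Suc R"
  shows "2 * rconv 0 (excess (2 ^ R)) odd_count m =
    (if m < 2 ^ R then 2 * low_excess (2 ^ R) else low_excess (2 ^ R) + high_excess (2 ^ R)) *
      rconv 0 odd_count odd_count m"
proof (cases "m < 2 ^ R")
  case True
  have "rconv 0 (excess (2 ^ R)) odd_count m = rconv 0 (\<lambda>u. low_excess (2 ^ R) * odd_count u) odd_count m"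
    using True by (intro rconv_cong) (auto simp: excess_def)
  thus ?thesis using True by (simp add: rconv_scale)
next
  case False
  then obtain r where r: "m = 2 ^ R + r" using le_Suc_ex linorder_not_less by blast
  have rR: "r < 2 ^ R" using assms r by simp
  let ?L = "low_excess (2 ^ R)" and ?U = "high_excess (2 ^ R)" and ?c = "rconv 0 odd_count odd_count r"
  have "rconv 0 (excess (2 ^ R)) odd_count m =
      rconv 0 (\<lambda>u. ?L * odd_count u) (\<lambda>w. 2 ^ R * odd_count w) r +
      rconv 0 (\<lambda>u. (?U * 2 ^ R) * odd_count u) odd_count r"
    unfolding r rconv_0_top[OF rR] using rR
    by (intro arg_cong2[where f = "(+)"] rconv_cong) (auto simp: excess_def odd_count_top)
  also have "\<dots> = (?L + ?U) * 2 ^ R * ?c"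
    unfolding rconv_scale by (simp add: algebra_simps)
  finally have "2 * rconv 0 (excess (2 ^ R)) odd_count m = (?L + ?U) * (2 * 2 ^ R * ?c)" by simp
  also have "rconv 0 odd_count odd_count m =
      rconv 0 odd_count (\<lambda>w. 2 ^ R * odd_count w) r + rconv 0 (\<lambda>u. 2 ^ R * odd_count u) odd_count r"
    unfolding r rconv_0_top[OF rR] using rR
    by (intro arg_cong2[where f = "(+)"] rconv_cong) (auto simp: odd_count_top)
  hence "2 * 2 ^ R * ?c = rconv 0 odd_count odd_count m" by (simp add: rconv_scale)
  finally show ?thesis using False by simp
qed

lemma two_count_top:
  "m < 2 ^ Suc R \<Longrightarrow> two_count (2 ^ Suc R + m) = 2 ^ Suc R * two_count m + excess (2 ^ R) m"
proof (induction R arbitrary: m)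
  case 0
  hence "m = 0 \<or> m = 1" by auto
  thus ?case
  proof
    assume "m = 0"
    thus ?thesis using two_count_rec[of 2] two_count_small
      by (simp add: rconv_one[simplified] excess_def low_excess_def)
  next
    \<comment> \<open>At \<open>n = 3\<close> the core of size 3 with empty quotient supplies
      \<open>high_excess 1 = 1\<close>.\<close>
    assume "m = 1"
    thus ?thesis using two_count_rec[of 3] two_count_small odd_count_1
      by (simp add: rconv_one[simplified] excess_def high_excess_def odd_count_0)
  qed
next
  case (Suc R)
  define r where "r = m div 2"
  let ?Q = "2 ^ Suc R :: nat"
  let ?q = "2 ^ Suc R :: real"
  let ?A = odd_count and ?B = two_count
  have r: "r < ?Q" using Suc.prems by (simp add: r_def less_mult_imp_div_less)
  have half: "(2 ^ Suc (Suc R) + m) div 2 = ?Q + r" by (simp add: r_def)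
  have A: "?A (?Q + u) = ?q * ?A u" if "u \<le> r" for u
    using odd_count_top[of u "Suc R"] that r by simp
  have B: "?B (?Q + u) = ?q * ?B u + excess (2 ^ R) u" if "u \<le> r" for u
    using Suc.IH[of u] that r by simp
  have Am: "rconv 0 ?A ?A r = ?A m" using odd_count_rec[of m] by (simp add: r_def)
  have "rconv 0 ?B ?A (?Q + r) =
      rconv 0 ?B (\<lambda>w. ?q * ?A w) r + rconv 0 (\<lambda>u. ?q * ?B u + excess (2 ^ R) u) ?A r"
    unfolding rconv_0_top[OF r] using A B by (intro arg_cong2[where f = "(+)"] rconv_cong) auto
  hence T: "rconv 0 ?B ?A (?Q + r) = 2 * ?q * rconv 0 ?B ?A r + rconv 0 (excess (2 ^ R)) ?A r"
    by (simp add: rconv_scale rconv_add)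
  \<comment> \<open>The carry term is present only for \<open>r < 2 ^ R\<close>; both its arguments
    contain the bit \<open>2 ^ R\<close>, whence the square.\<close>
  have S: "rconv 1 ?A ?A (?Q + r) = 2 * ?q * rconv 1 ?A ?A r + (if r < 2 ^ R then (2 ^ R)\<^sup>2 * ?A m else 0)"
  proof -
    have "rconv 1 ?A ?A (?Q + r) = rconv 1 ?A (\<lambda>w. ?q * ?A w) r + rconv 1 (\<lambda>u. ?q * ?A u) ?A r +
        (if r < 2 ^ R then rconv 0 (\<lambda>u. 2 ^ R * ?A u) (\<lambda>w. 2 ^ R * ?A w) r else 0)"
      unfolding rconv_1_top[OF r] using A odd_count_top[of _ R]
      by (intro arg_cong2[where f = "(+)"] if_cong rconv_cong refl) auto
    thus ?thesis unfolding rconv_scale Am by (simp add: power2_eq_square)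
  qed
  \<comment> \<open>Adding a multiple of 4 keeps the residue, and after halving it becomes a new top
    bit, so the term for the core of size 3 is merely scaled.\<close>
  have C: "(if (2 ^ Suc (Suc R) + m) mod 4 = 3 then rconv 0 ?A ?A ((2 ^ Suc (Suc R) + m - 3) div 2) else 0) =
      2 * ?q * (if m mod 4 = 3 then rconv 0 ?A ?A ((m - 3) div 2) else 0)"
  proof (cases "m mod 4 = 3")
    case True
    define t where "t = (m - 3) div 2"
    have "3 \<le> m" using True by presburger
    hence "(2 ^ Suc (Suc R) + m - 3) div 2 = ?Q + t" by (simp add: t_def)
    moreover have t: "t < ?Q" using Suc.prems by (simp add: t_def less_mult_imp_div_less)
    have "rconv 0 ?A ?A (?Q + t) = rconv 0 ?A (\<lambda>w. ?q * ?A w) t + rconv 0 (\<lambda>u. ?q * ?A u) ?A t"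
      unfolding rconv_0_top[OF t] using odd_count_top[of _ "Suc R"] t
      by (intro arg_cong2[where f = "(+)"] rconv_cong) auto
    moreover have "(2 ^ Suc (Suc R) + m) mod 4 = 3" using True by (simp add: mod_add_left_eq)
    ultimately show ?thesis using True by (simp add: rconv_scale t_def)
  next
    case False
    hence "(2 ^ Suc (Suc R) + m) mod 4 \<noteq> 3" by simp
    thus ?thesis using False by simp
  qed
  have "?B (2 ^ Suc (Suc R) + m) = 2 * (2 * ?q * rconv 0 ?B ?A r + rconv 0 (excess (2 ^ R)) ?A r)
      + (2 * ?q * rconv 1 ?A ?A r + (if r < 2 ^ R then (2 ^ R)\<^sup>2 * ?A m else 0))
      + 2 * ?q * (if m mod 4 = 3 then rconv 0 ?A ?A ((m - 3) div 2) else 0)"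
    unfolding two_count_rec[of "2 ^ Suc (Suc R) + m"] half C T S ..
  also have "\<dots> = 2 * ?q * ?B m + 2 * rconv 0 (excess (2 ^ R)) ?A r
      + (if r < 2 ^ R then (2 ^ R)\<^sup>2 * ?A m else 0)"
    unfolding two_count_rec[of m] r_def[symmetric] by (simp add: algebra_simps)
  also have "\<dots> = 2 * ?q * ?B m + excess ?Q m"
  proof -
    have iff: "m < ?Q \<longleftrightarrow> r < 2 ^ R" by (auto simp: r_def)
    have low: "2 * low_excess (2 ^ R) + (2 ^ R)\<^sup>2 = low_excess ?Q"
      using low_excess_double[of "2 ^ R"] by simp
    have high: "low_excess (2 ^ R) + high_excess (2 ^ R) = high_excess ?Q"
      using high_excess_double[of "2 ^ R"] by simp
    show ?thesis
      unfolding rconv_excess[OF r] Am excess_def iff low[symmetric] high[symmetric]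
      by (simp add: algebra_simps)
  qed
  finally show ?case by simp
qed

theorem theorem1p4:
  fixes R m n :: nat
  assumes "R \<ge> 1" and "m < 2 ^ R" and "n = 2 ^ R + m"
  shows "(m < 2 ^ (R - 1) \<longrightarrow>
            real (a_mod4 2 n) = 2 ^ R * real (a_mod4 2 m)
              + real ((2 ^ (R - 1)) choose 2) * real (a_odd m))
       \<and> (2 ^ (R - 1) \<le> m \<longrightarrow>
            real (a_mod4 2 n) = 2 ^ R * real (a_mod4 2 m)
              + (real ((2 ^ (R - 1)) choose 3) + 2 ^ (R - 1)) * (real (a_odd m) / 2 ^ (R - 1)))"
proof -
  obtain r where r: "R = Suc r" using assms(1) by (cases R) auto
  have "two_count n = 2 ^ R * two_count m + excess (2 ^ r) m"
    using two_count_top[of m r] assms by (simp add: r)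
  thus ?thesis
    by (auto simp: two_count_def odd_count_def excess_def low_excess_def high_excess_def r)
qed

end
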